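(* Let $F$ be a finitely generated free group, let $F'\le F$ be a free factor of $F$, let $\varphi\colon F'\to F$ be a monomorphism, and let $G'=F*_\varphi$ be the associated partial ascending HNN extension. Then there is an ascending HNN extension $G$ of a finitely generated free group and an injective homomorphism $G'\hookrightarrow G$. Moreover, the injection can be chosen to arise from an extension of $\varphi$ as follows: there exist a finitely generated free group $F''$, an injective homomorphism $j\colon F\to F''$, and a monomorphism $\Phi\colon F''\to F''$ such that $\Phi(j(x))=j(\varphi(x))$ for all $x\in F'$, and such that the homomorphism $F*_\varphi\to F''*_\Phi$ that equals $j$ on $F$ and sends the stable letter to the stable letter is injective.
   Context: Let $F$ be a free group, $F'\le F$ a free factor, and $\varphi\colon F'\to F$ a monomorphism. The partial ascending HNN extension $F*_\varphi$ is the HNN extension $\langle F,t\mid txt^{-1}=\varphi(x)\ (x\in F')\rangle$; that is, if $F=\langle a_i: i\in I\rangle$ with free basis $\{a_i\}_{i\in I}$ and $F'=\langle a_i: i\in J\rangle$ with $J\subseteq I$, then $F*_\varphi=\langle t,a_i\ (i\in I)\mid ta_it^{-1}=\varphi(a_i)\ (i\in J)\rangle$. It is an ascending HNN extension if $F'=F$; thus for a monomorphism $\Phi\colon F''\to F''$ of a free group, $F''*_\Phi=\langle F'',t\mid txt^{-1}=\Phi(x)\ (x\in F'')\rangle$. The element $t$ is the stable letter. *)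

theory Defs
  imports "HOL-Algebra.Generated_Groups"
begin

section \<open>Group words\<close>

text \<open>A letter \<open>(x, True)\<close> stands for \<open>x\<close>, a letter \<open>(x, False)\<close> for the inverse of \<open>x\<close>.\<close>

type_synonym 'x gword = "('x \<times> bool) list"

definition gwords :: "'x set \<Rightarrow> 'x gword set" where
  "gwords X = lists (X \<times> UNIV)"

definition gword_reduced :: "'x gword \<Rightarrow> bool" where
  "gword_reduced w \<longleftrightarrow> successively (\<lambda>(x, b) (y, c). \<not> (x = y \<and> b \<noteq> c)) w"

fun gword_val :: "('a, 'm) monoid_scheme \<Rightarrow> ('x \<Rightarrow> 'a) \<Rightarrow> 'x gword \<Rightarrow> 'a" where
  "gword_val G f [] = \<one>\<^bsub>G\<^esub>"
| "gword_val G f ((x, b) # w) = (if b then f x else inv\<^bsub>G\<^esub> (f x)) \<otimes>\<^bsub>G\<^esub> gword_val G f w"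


section \<open>Free groups and free factors\<close>

text \<open>\<open>B\<close> is a free basis if every element is the value of exactly one reduced word in \<open>B\<close>.\<close>

definition free_basis :: "('a, 'm) monoid_scheme \<Rightarrow> 'a set \<Rightarrow> bool" where
  "free_basis G B \<longleftrightarrow>
     B \<subseteq> carrier G \<and> bij_betw (gword_val G id) {w \<in> gwords B. gword_reduced w} (carrier G)"

definition is_free_group :: "('a, 'm) monoid_scheme \<Rightarrow> bool" where
  "is_free_group G \<longleftrightarrow> group G \<and> (\<exists>B. free_basis G B)"

definition finitely_generated_group :: "('a, 'm) monoid_scheme \<Rightarrow> bool" where
  "finitely_generated_group G \<longleftrightarrow>
     (\<exists>S. finite S \<and> S \<subseteq> carrier G \<and> generate G S = carrier G)"

text \<open>The notion is used for free groups only: \<open>H\<close> is a free factor of the free group \<open>G\<close> if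
  \<open>G\<close> has a free basis \<open>{a\<^sub>i}\<close>, \<open>i \<in> I\<close>, such that \<open>H\<close> is generated by the \<open>a\<^sub>i\<close> with \<open>i\<close> in
  some \<open>J \<subseteq> I\<close>.\<close>

definition free_factor :: "('a, 'm) monoid_scheme \<Rightarrow> 'a set \<Rightarrow> bool" where
  "free_factor G H \<longleftrightarrow> (\<exists>B A. free_basis G B \<and> A \<subseteq> B \<and> H = generate G A)"


section \<open>Groups given by generators and relators\<close>

text \<open>The congruence on words over \<open>X\<close> generated by free cancellation and \<open>r = 1\<close> for \<open>r \<in> R\<close>;
  the classes form the quotient of the free group on \<open>X\<close> by the normal closure of \<open>R\<close>.\<close>

inductive_set pres_rel :: "'x set \<Rightarrow> 'x gword set \<Rightarrow> ('x gword \<times> 'x gword) set"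
  for X :: "'x set" and R :: "'x gword set"
where
  refl: "u \<in> gwords X \<Longrightarrow> (u, u) \<in> pres_rel X R"
| sym: "(u, v) \<in> pres_rel X R \<Longrightarrow> (v, u) \<in> pres_rel X R"
| trans: "(u, v) \<in> pres_rel X R \<Longrightarrow> (v, w) \<in> pres_rel X R \<Longrightarrow> (u, w) \<in> pres_rel X R"
| cancel: "u \<in> gwords X \<Longrightarrow> v \<in> gwords X \<Longrightarrow> x \<in> X \<Longrightarrow>
    (u @ [(x, b), (x, \<not> b)] @ v, u @ v) \<in> pres_rel X R"
| relator: "u \<in> gwords X \<Longrightarrow> v \<in> gwords X \<Longrightarrow> r \<in> R \<Longrightarrow> r \<in> gwords X \<Longrightarrow>
    (u @ r @ v, u @ v) \<in> pres_rel X R"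

definition pres_class :: "'x set \<Rightarrow> 'x gword set \<Rightarrow> 'x gword \<Rightarrow> 'x gword set" where
  "pres_class X R w = pres_rel X R `` {w}"

definition presented_group :: "'x set \<Rightarrow> 'x gword set \<Rightarrow> 'x gword set monoid" where
  "presented_group X R =
     \<lparr>carrier = gwords X // pres_rel X R,
      mult = (\<lambda>U V. \<Union>u\<in>U. \<Union>v\<in>V. pres_class X R (u @ v)),
      one = pres_class X R []\<rparr>"


section \<open>HNN extensions\<close>

text \<open>The presentation \<open>\<langle>F, t | t x t\<^sup>-\<^sup>1 = \<phi> x (x \<in> H)\<rangle>\<close>: the generator \<open>Some x\<close> is the element
  \<open>x\<close> of \<open>F\<close>, \<open>None\<close> is the stable letter \<open>t\<close>, and including \<open>F\<close> in the presentation means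
  including its multiplication table among the relators.\<close>

definition hnn_gens :: "('a, 'm) monoid_scheme \<Rightarrow> 'a option set" where
  "hnn_gens F = insert None (Some ` carrier F)"

definition hnn_relators ::
  "('a, 'm) monoid_scheme \<Rightarrow> 'a set \<Rightarrow> ('a \<Rightarrow> 'a) \<Rightarrow> 'a option gword set" where
  "hnn_relators F H \<phi> =
     {[(Some x, True), (Some y, True), (Some (x \<otimes>\<^bsub>F\<^esub> y), False)] | x y.
        x \<in> carrier F \<and> y \<in> carrier F} \<union>
     {[(None, True), (Some x, True), (None, False), (Some (\<phi> x), False)] | x. x \<in> H}"

definition hnn ::
  "('a, 'm) monoid_scheme \<Rightarrow> 'a set \<Rightarrow> ('a \<Rightarrow> 'a) \<Rightarrow> 'a option gword set monoid" where
  "hnn F H \<phi> = presented_group (hnn_gens F) (hnn_relators F H \<phi>)"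

definition hnn_base ::
  "('a, 'm) monoid_scheme \<Rightarrow> 'a set \<Rightarrow> ('a \<Rightarrow> 'a) \<Rightarrow> 'a \<Rightarrow> 'a option gword set" where
  "hnn_base F H \<phi> x = pres_class (hnn_gens F) (hnn_relators F H \<phi>) [(Some x, True)]"

definition hnn_stable ::
  "('a, 'm) monoid_scheme \<Rightarrow> 'a set \<Rightarrow> ('a \<Rightarrow> 'a) \<Rightarrow> 'a option gword set" where
  "hnn_stable F H \<phi> = pres_class (hnn_gens F) (hnn_relators F H \<phi>) [(None, True)]"

abbreviation ascending_hnn ::
  "('a, 'm) monoid_scheme \<Rightarrow> ('a \<Rightarrow> 'a) \<Rightarrow> 'a option gword set monoid" where
  "ascending_hnn F \<Phi> \<equiv> hnn F (carrier F) \<Phi>"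


section \<open>Basic properties\<close>

lemma gwords_simps [simp]:
  "[] \<in> gwords X"
  "(p # w) \<in> gwords X \<longleftrightarrow> fst p \<in> X \<and> w \<in> gwords X"
  "(u @ v) \<in> gwords X \<longleftrightarrow> u \<in> gwords X \<and> v \<in> gwords X"
  by (cases p; auto simp: gwords_def)+

lemma pres_rel_gwords:
  "(u, v) \<in> pres_rel X R \<Longrightarrow> u \<in> gwords X \<and> v \<in> gwords X"
  by (induction rule: pres_rel.induct) auto

lemma equiv_pres_rel: "equiv (gwords X) (pres_rel X R)"
  by (rule equivI)
    (auto simp: refl_on_def sym_def trans_def dest: pres_rel_gwords
          intro: pres_rel.refl pres_rel.sym pres_rel.trans)

lemma pres_rel_append_left:
  "(u, v) \<in> pres_rel X R \<Longrightarrow> w \<in> gwords X \<Longrightarrow> (w @ u, w @ v) \<in> pres_rel X R"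
proof (induction rule: pres_rel.induct)
  case (cancel u v x b)
  then show ?case using pres_rel.cancel[of "w @ u" X v x b R] by simp
next
  case (relator u v r)
  then show ?case using pres_rel.relator[of "w @ u" X v r R] by simp
qed (auto intro: pres_rel.refl pres_rel.sym pres_rel.trans)

lemma pres_rel_append_right:
  "(u, v) \<in> pres_rel X R \<Longrightarrow> w \<in> gwords X \<Longrightarrow> (u @ w, v @ w) \<in> pres_rel X R"
proof (induction rule: pres_rel.induct)
  case (cancel u v x b)
  then show ?case using pres_rel.cancel[of u X "v @ w" x b R] by simp
next
  case (relator u v r)
  then show ?case using pres_rel.relator[of u X "v @ w" r R] by simp
qed (auto intro: pres_rel.refl pres_rel.sym pres_rel.trans)

lemma pres_rel_append:
  "(u, u') \<in> pres_rel X R \<Longrightarrow> (v, v') \<in> pres_rel X R \<Longrightarrow> (u @ v, u' @ v') \<in> pres_rel X R"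
  by (meson pres_rel.trans pres_rel_append_left pres_rel_append_right pres_rel_gwords)

lemma pres_class_eq_iff:
  "u \<in> gwords X \<Longrightarrow> v \<in> gwords X \<Longrightarrow>
     pres_class X R u = pres_class X R v \<longleftrightarrow> (u, v) \<in> pres_rel X R"
  unfolding pres_class_def by (simp add: eq_equiv_class_iff[OF equiv_pres_rel])

lemma carrier_presented_group:
  "carrier (presented_group X R) = pres_class X R ` gwords X"
  by (auto simp: presented_group_def quotient_def pres_class_def)

lemma one_presented_group: "\<one>\<^bsub>presented_group X R\<^esub> = pres_class X R []"
  by (simp add: presented_group_def)

lemma mult_presented_group:
  assumes "u \<in> gwords X" "v \<in> gwords X"
  shows "pres_class X R u \<otimes>\<^bsub>presented_group X R\<^esub> pres_class X R v = pres_class X R (u @ v)"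
proof -
  have eq: "pres_class X R (u' @ v') = pres_class X R (u @ v)"
    if "u' \<in> pres_class X R u" "v' \<in> pres_class X R v" for u' v'
  proof -
    have "(u @ v, u' @ v') \<in> pres_rel X R"
      using that by (intro pres_rel_append) (simp_all add: pres_class_def)
    then show ?thesis
      using pres_rel_gwords pres_class_eq_iff by metis
  qed
  have mem: "u \<in> pres_class X R u" "v \<in> pres_class X R v"
    using assms by (simp_all add: pres_class_def pres_rel.refl)
  have "(\<Union>u'\<in>pres_class X R u. \<Union>v'\<in>pres_class X R v. pres_class X R (u' @ v')) =
      pres_class X R (u @ v)"
    using eq mem by blast
  then show ?thesis
    by (simp add: presented_group_def)
qed

lemma pres_rel_inverse:
  "u \<in> gwords X \<Longrightarrow> (map (\<lambda>(x, b). (x, \<not> b)) (rev u) @ u, []) \<in> pres_rel X R"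
proof (induction u)
  case Nil
  then show ?case by (simp add: pres_rel.refl)
next
  case (Cons p u)
  obtain x b where p: "p = (x, b)" by fastforce
  let ?i = "map (\<lambda>(x, b). (x, \<not> b)) (rev u)"
  have i: "?i \<in> gwords X" using Cons by (auto simp: gwords_def)
  have "(?i @ [(x, \<not> b), (x, \<not> \<not> b)] @ u, ?i @ u) \<in> pres_rel X R"
    using Cons p i by (intro pres_rel.cancel) auto
  then show ?case using Cons p by (auto intro: pres_rel.trans)
qed

lemma group_presented_group: "group (presented_group X R)"
proof (rule groupI)
  fix U assume "U \<in> carrier (presented_group X R)"
  then obtain u where u: "u \<in> gwords X" "U = pres_class X R u"
    by (auto simp: carrier_presented_group)
  let ?i = "map (\<lambda>(x, b). (x, \<not> b)) (rev u)"
  have i: "?i \<in> gwords X" using u by (auto simp: gwords_def)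
  show "\<exists>V\<in>carrier (presented_group X R). V \<otimes>\<^bsub>presented_group X R\<^esub> U = \<one>\<^bsub>presented_group X R\<^esub>"
    using u i pres_rel_inverse[OF u(1), of R]
    by (intro bexI[of _ "pres_class X R ?i"])
       (auto simp: carrier_presented_group mult_presented_group one_presented_group
          pres_class_eq_iff)
qed (auto simp: carrier_presented_group mult_presented_group one_presented_group)

lemma (in group) gword_val_closed:
  "f ` X \<subseteq> carrier G \<Longrightarrow> w \<in> gwords X \<Longrightarrow> gword_val G f w \<in> carrier G"
  by (induction w) (auto split: if_splits)

lemma (in group) gword_val_append:
  "f ` X \<subseteq> carrier G \<Longrightarrow> u \<in> gwords X \<Longrightarrow> v \<in> gwords X \<Longrightarrow>
     gword_val G f (u @ v) = gword_val G f u \<otimes> gword_val G f v"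
proof (induction u)
  case (Cons p u)
  obtain x b where p: "p = (x, b)" by fastforce
  have "f x \<in> carrier G" using Cons.prems p by auto
  then show ?case using Cons p
    by (auto simp: m_assoc gword_val_closed)
qed (auto simp: gword_val_closed)

lemma (in group) gword_val_pres_rel:
  assumes f: "f ` X \<subseteq> carrier G"
    and R: "\<And>r. r \<in> R \<Longrightarrow> r \<in> gwords X \<Longrightarrow> gword_val G f r = \<one>"
  shows "(u, v) \<in> pres_rel X R \<Longrightarrow> gword_val G f u = gword_val G f v"
proof (induction rule: pres_rel.induct)
  case (cancel u v x b)
  have "f x \<in> carrier G" using f cancel by auto
  then have "gword_val G f [(x, b), (x, \<not> b)] = \<one>" by auto
  then show ?case
    using cancel f gword_val_closed[OF f] 
    by (simp add: gword_val_append[OF f] del: gword_val.simps append_Cons)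
next
  case (relator u v r)
  then show ?case using gword_val_closed[OF f] by (simp add: R gword_val_append[OF f])
qed auto

lemma (in group) presented_group_universal:
  assumes f: "f ` X \<subseteq> carrier G"
    and R: "\<And>r. r \<in> R \<Longrightarrow> r \<in> gwords X \<Longrightarrow> gword_val G f r = \<one>"
  shows "\<exists>\<theta> \<in> hom (presented_group X R) G. \<forall>w \<in> gwords X. \<theta> (pres_class X R w) = gword_val G f w"
proof -
  define \<theta> where "\<theta> = (\<lambda>U. gword_val G f (SOME u. u \<in> U))"
  have val: "\<theta> (pres_class X R w) = gword_val G f w" if w: "w \<in> gwords X" for w
  proof -
    have "w \<in> pres_class X R w" using w by (auto simp: pres_class_def intro: pres_rel.refl)
    then have "(SOME u. u \<in> pres_class X R w) \<in> pres_class X R w" by (rule someI)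
    then have "(w, SOME u. u \<in> pres_class X R w) \<in> pres_rel X R" by (simp add: pres_class_def)
    from gword_val_pres_rel[OF f R this] show ?thesis by (simp add: \<theta>_def)
  qed
  have "\<theta> \<in> hom (presented_group X R) G"
    by (rule homI)
       (auto simp: carrier_presented_group mult_presented_group val gword_val_closed[OF f]
          gword_val_append[OF f])
  with val show ?thesis by blast
qed

lemma group_hnn: "group (hnn F H \<phi>)"
  by (simp add: hnn_def group_presented_group)

lemma hnn_base_closed: "x \<in> carrier F \<Longrightarrow> hnn_base F H \<phi> x \<in> carrier (hnn F H \<phi>)"
  by (auto simp: hnn_def hnn_base_def carrier_presented_group hnn_gens_def)

lemma hnn_stable_closed: "hnn_stable F H \<phi> \<in> carrier (hnn F H \<phi>)"
  by (auto simp: hnn_def hnn_stable_def carrier_presented_group hnn_gens_def)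

lemma hnn_base_hom:
  assumes "group F"
  shows "hnn_base F H \<phi> \<in> hom F (hnn F H \<phi>)"
proof (rule homI)
  fix x y assume xy: "x \<in> carrier F" "y \<in> carrier F"
  interpret F: group F by fact
  let ?X = "hnn_gens F" and ?R = "hnn_relators F H \<phi>"
  let ?z = "x \<otimes>\<^bsub>F\<^esub> y"
  have [simp]: "Some x \<in> ?X" "Some y \<in> ?X" "Some ?z \<in> ?X"
    using xy by (auto simp: hnn_gens_def)
  have "[(Some x, True), (Some y, True), (Some ?z, False)] \<in> ?R"
    using xy by (auto simp: hnn_relators_def)
  then have "([] @ [(Some x, True), (Some y, True), (Some ?z, False)] @ [(Some ?z, True)],
      [] @ [(Some ?z, True)]) \<in> pres_rel ?X ?R"
    by (intro pres_rel.relator) auto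
  moreover have "([(Some x, True), (Some y, True)] @ [(Some ?z, False), (Some ?z, \<not> False)] @ [],
      [(Some x, True), (Some y, True)] @ []) \<in> pres_rel ?X ?R"
    by (intro pres_rel.cancel) auto
  ultimately have "([(Some ?z, True)], [(Some x, True), (Some y, True)]) \<in> pres_rel ?X ?R"
    by (auto intro: pres_rel.sym pres_rel.trans)
  then show "hnn_base F H \<phi> (x \<otimes>\<^bsub>F\<^esub> y) =
      hnn_base F H \<phi> x \<otimes>\<^bsub>hnn F H \<phi>\<^esub> hnn_base F H \<phi> y"
    by (simp add: hnn_def hnn_base_def mult_presented_group pres_class_eq_iff)
qed (rule hnn_base_closed)

lemma hnn_stable_conj:
  assumes "x \<in> H" "x \<in> carrier F" "\<phi> x \<in> carrier F"
  shows "hnn_stable F H \<phi> \<otimes>\<^bsub>hnn F H \<phi>\<^esub> hnn_base F H \<phi> x \<otimes>\<^bsub>hnn F H \<phi>\<^esub>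
           inv\<^bsub>hnn F H \<phi>\<^esub> (hnn_stable F H \<phi>) = hnn_base F H \<phi> (\<phi> x)"
proof -
  interpret G: group "hnn F H \<phi>" by (rule group_hnn)
  let ?X = "hnn_gens F" and ?R = "hnn_relators F H \<phi>"
  have [simp]: "None \<in> ?X" "Some x \<in> ?X" "Some (\<phi> x) \<in> ?X"
    using assms by (auto simp: hnn_gens_def)
  let ?t = "(None, True)" and ?t' = "(None, False)"
  have "[?t, (Some x, True), ?t', (Some (\<phi> x), False)] \<in> ?R"
    using assms by (auto simp: hnn_relators_def)
  then have "([] @ [?t, (Some x, True), ?t', (Some (\<phi> x), False)] @ [(Some (\<phi> x), True), ?t],
      [] @ [(Some (\<phi> x), True), ?t]) \<in> pres_rel ?X ?R"
    by (intro pres_rel.relator) auto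
  moreover have "([?t, (Some x, True), ?t'] @ [(Some (\<phi> x), False), (Some (\<phi> x), \<not> False)] @ [?t],
      [?t, (Some x, True), ?t'] @ [?t]) \<in> pres_rel ?X ?R"
    by (intro pres_rel.cancel) auto
  moreover have "([?t, (Some x, True)] @ [?t', (None, \<not> False)] @ [],
      [?t, (Some x, True)] @ []) \<in> pres_rel ?X ?R"
    by (intro pres_rel.cancel) auto
  ultimately have "([?t, (Some x, True)], [(Some (\<phi> x), True), ?t]) \<in> pres_rel ?X ?R"
    by simp (meson pres_rel.sym pres_rel.trans)
  then have "hnn_stable F H \<phi> \<otimes>\<^bsub>hnn F H \<phi>\<^esub> hnn_base F H \<phi> x =
      hnn_base F H \<phi> (\<phi> x) \<otimes>\<^bsub>hnn F H \<phi>\<^esub> hnn_stable F H \<phi>"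
    by (simp add: hnn_def hnn_base_def hnn_stable_def mult_presented_group pres_class_eq_iff)
  then show ?thesis
    using assms by (simp add: G.m_assoc hnn_base_closed hnn_stable_closed)
qed

lemma hnn_universal:
  assumes K: "group K" and F: "group F" and f: "f \<in> hom F K" and s: "s \<in> carrier K"
    and H: "H \<subseteq> carrier F" "\<phi> ` H \<subseteq> carrier F"
    and conj: "\<And>x. x \<in> H \<Longrightarrow> s \<otimes>\<^bsub>K\<^esub> f x \<otimes>\<^bsub>K\<^esub> inv\<^bsub>K\<^esub> s = f (\<phi> x)"
  shows "\<exists>\<theta> \<in> hom (hnn F H \<phi>) K.
           (\<forall>x\<in>carrier F. \<theta> (hnn_base F H \<phi> x) = f x) \<and> \<theta> (hnn_stable F H \<phi>) = s"
proof -
  interpret K: group K by fact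
  interpret F: group F by fact
  let ?g = "case_option s f"
  have fc: "f x \<in> carrier K" if "x \<in> carrier F" for x using f that by (auto simp: hom_def)
  have g: "?g ` hnn_gens F \<subseteq> carrier K" using s fc by (auto simp: hnn_gens_def)
  have rel: "gword_val K ?g r = \<one>\<^bsub>K\<^esub>" if "r \<in> hnn_relators F H \<phi>" for r
    using that unfolding hnn_relators_def
  proof (elim UnE CollectE exE conjE)
    fix x y assume r: "r = [(Some x, True), (Some y, True), (Some (x \<otimes>\<^bsub>F\<^esub> y), False)]"
      and xy: "x \<in> carrier F" "y \<in> carrier F"
    then show ?thesis
      using fc[OF xy(1)] fc[OF xy(2)] hom_mult[OF f xy]
      by (simp add: K.m_assoc[symmetric])
  next
    fix x assume r: "r = [(None, True), (Some x, True), (None, False), (Some (\<phi> x), False)]"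
      and x: "x \<in> H"
    have "f x \<in> carrier K" "f (\<phi> x) \<in> carrier K" using H x fc by auto
    then show ?thesis using r s conj[OF x] by (simp add: K.m_assoc[symmetric])
  qed
  obtain \<theta> where \<theta>: "\<theta> \<in> hom (hnn F H \<phi>) K"
    "\<And>w. w \<in> gwords (hnn_gens F) \<Longrightarrow>
      \<theta> (pres_class (hnn_gens F) (hnn_relators F H \<phi>) w) = gword_val K ?g w"
    using K.presented_group_universal[OF g, of "hnn_relators F H \<phi>"] rel
    unfolding hnn_def by blast
  show ?thesis
    using \<theta> fc s
    by (intro bexI[of _ \<theta>]) (auto simp: hnn_base_def hnn_stable_def hnn_gens_def)
qed

lemma hnn_hom_unique:
  assumes K: "group K" and \<theta>: "\<theta> \<in> hom (hnn F H \<phi>) K" and \<eta>: "\<eta> \<in> hom (hnn F H \<phi>) K"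
    and base: "\<And>x. x \<in> carrier F \<Longrightarrow> \<theta> (hnn_base F H \<phi> x) = \<eta> (hnn_base F H \<phi> x)"
    and stable: "\<theta> (hnn_stable F H \<phi>) = \<eta> (hnn_stable F H \<phi>)"
    and g: "g \<in> carrier (hnn F H \<phi>)"
  shows "\<theta> g = \<eta> g"
proof -
  let ?X = "hnn_gens F" and ?R = "hnn_relators F H \<phi>"
  let ?c = "pres_class ?X ?R" and ?G = "hnn F H \<phi>"
  interpret K: group K by fact
  interpret G: group ?G by (rule group_hnn)
  interpret t: group_hom ?G K \<theta> by unfold_locales fact
  interpret e: group_hom ?G K \<eta> by unfold_locales fact
  have pos: "\<theta> (?c [(x, True)]) = \<eta> (?c [(x, True)])" if "x \<in> ?X" for x
    using that base stable by (auto simp: hnn_gens_def hnn_base_def hnn_stable_def)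
  have mult: "?c (u @ v) = ?c u \<otimes>\<^bsub>?G\<^esub> ?c v" if "u \<in> gwords ?X" "v \<in> gwords ?X" for u v
    using that by (simp add: hnn_def mult_presented_group)
  have cl: "?c u \<in> carrier ?G" if "u \<in> gwords ?X" for u
    using that by (auto simp: hnn_def carrier_presented_group)
  have inv: "?c [(x, False)] = inv\<^bsub>?G\<^esub> (?c [(x, True)])" if x: "x \<in> ?X" for x
  proof -
    have "([] @ [(x, False), (x, \<not> False)] @ [], [] @ []) \<in> pres_rel ?X ?R"
      using x by (intro pres_rel.cancel) auto
    then have "?c ([(x, False)] @ [(x, True)]) = \<one>\<^bsub>?G\<^esub>"
      using x by (simp add: hnn_def one_presented_group pres_class_eq_iff)
    then show ?thesis
      using x mult[of "[(x, False)]" "[(x, True)]"] cl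
      by (intro G.inv_equality[symmetric]) auto
  qed
  have letter: "\<theta> (?c [(x, b)]) = \<eta> (?c [(x, b)])" if "x \<in> ?X" for x b
    using that pos inv cl by (cases b) auto
  have "\<theta> (?c w) = \<eta> (?c w)" if "w \<in> gwords ?X" for w
    using that
  proof (induction w)
    case Nil
    have "?c [] = \<one>\<^bsub>?G\<^esub>" by (simp add: hnn_def one_presented_group)
    then show ?case by simp
  next
    case (Cons p w)
    then show ?case
      using mult[of "[p]" w] letter[of "fst p" "snd p"] cl by auto
  qed
  then show ?thesis using g by (auto simp: hnn_def carrier_presented_group)
qed

end

theory Submission
  imports Defs "HOL-Algebra.Bij" "HOL-Algebra.Elementary_Groups"
begin

text \<open>Let \<open>B\<close> be a basis of \<open>F\<close> such that \<open>A \<subseteq> B\<close> is a basis of \<open>F'\<close>, and put \<open>C = B - A\<close>.  Take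
  \<open>F'' = F * \<langle>x, y\<rangle>\<close>, and let \<open>\<Phi>\<close> be \<open>\<phi>\<close> on \<open>A\<close> and send the letters in \<open>C\<close> as well as \<open>x\<close> and
  \<open>y\<close> to distinct conjugates \<open>x\<^sup>i y x\<^sup>-\<^sup>i\<close>, which freely generate a free subgroup of \<open>\<langle>x, y\<rangle>\<close>.  As
  \<open>\<phi>\<close> has values in \<open>F\<close>, \<open>\<Phi>\<close> is injective.  Moreover \<open>A\<close> and the elements \<open>\<Phi>\<^sup>i c\<close> with \<open>c \<in> C\<close>
  and \<open>i \<ge> 0\<close> form a free family.  In the partial extension every element is of the form
  \<open>t\<^sup>-\<^sup>m v t\<^sup>n\<close>, where \<open>v\<close> is a word in \<open>A\<close> and the elements \<open>t\<^sup>i c t\<^sup>-\<^sup>i\<close>; the homomorphism to the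
  ascending extension sends \<open>t\<^sup>i c t\<^sup>-\<^sup>i\<close> to \<open>\<Phi>\<^sup>i c\<close>, so it has trivial kernel.\<close>

section \<open>Free groups of reduced words\<close>

text \<open>Left multiplication of a reduced word by one letter, which is prepended unless it
  cancels against the head. Elements of the free group are thus reduced words rather than classes,
  and \<open>foldr rcons u v\<close> is their product.\<close>

fun rcons :: "'x \<times> bool \<Rightarrow> 'x gword \<Rightarrow> 'x gword" where
  "rcons p [] = [p]"
| "rcons p (q # w) = (if q = (fst p, \<not> snd p) then w else p # q # w)"

definition free_reduce :: "'x gword \<Rightarrow> 'x gword" where
  "free_reduce w = foldr rcons w []"

lemma gword_reduced_Nil [simp]: "gword_reduced []"
  by (simp add: gword_reduced_def)

lemma gword_reduced_Cons:
  "gword_reduced (p # w) \<longleftrightarrow> gword_reduced w \<and> (w \<noteq> [] \<longrightarrow> hd w \<noteq> (fst p, \<not> snd p))"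
  by (cases w) (auto simp: gword_reduced_def split: prod.splits)

lemma gword_reduced_append:
  "gword_reduced (u @ v) \<longleftrightarrow> gword_reduced u \<and> gword_reduced v \<and>
     (u \<noteq> [] \<longrightarrow> v \<noteq> [] \<longrightarrow> hd v \<noteq> (fst (last u), \<not> snd (last u)))"
  by (auto simp: gword_reduced_def successively_append_iff split: prod.splits)

lemma gword_reduced_rcons: "gword_reduced w \<Longrightarrow> gword_reduced (rcons p w)"
  by (cases w) (auto simp: gword_reduced_Cons)

lemma gword_reduced_foldr_rcons:
  "gword_reduced v \<Longrightarrow> gword_reduced (foldr rcons u v)"
  by (induction u) (auto simp: gword_reduced_rcons)

lemma gword_reduced_free_reduce: "gword_reduced (free_reduce w)"
  by (simp add: free_reduce_def gword_reduced_foldr_rcons)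

lemma rcons_gwords: "fst p \<in> X \<Longrightarrow> w \<in> gwords X \<Longrightarrow> rcons p w \<in> gwords X"
  by (cases w) auto

lemma foldr_rcons_gwords: "u \<in> gwords X \<Longrightarrow> v \<in> gwords X \<Longrightarrow> foldr rcons u v \<in> gwords X"
  by (induction u) (auto simp: rcons_gwords)

lemma free_reduce_gwords: "w \<in> gwords X \<Longrightarrow> free_reduce w \<in> gwords X"
  by (simp add: free_reduce_def foldr_rcons_gwords)

lemma rcons_reduced: "gword_reduced (p # w) \<Longrightarrow> rcons p w = p # w"
  by (cases w) (auto simp: gword_reduced_Cons)

lemma foldr_rcons_reduced: "gword_reduced (u @ v) \<Longrightarrow> foldr rcons u v = u @ v"
proof (induction u)
  case (Cons p u)
  then show ?case
    using rcons_reduced[of p "u @ v"] by (simp add: gword_reduced_Cons)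
qed simp

lemma free_reduce_reduced: "gword_reduced w \<Longrightarrow> free_reduce w = w"
  using foldr_rcons_reduced[of w "[]"] by (simp add: free_reduce_def)

text \<open>Inverse letters act by inverse maps. Reducedness matters when \<open>w\<close> begins
  with \<open>(x, \<not> b)\<close>: the first step removes that letter, and the second must put it
  back without cancelling against what follows.\<close>

lemma rcons_cancel:
  assumes "gword_reduced w"
  shows "rcons (x, \<not> b) (rcons (x, b) w) = w"
proof (cases w)
  case (Cons q v)
  show ?thesis
  proof (cases "q = (x, \<not> b)")
    case True
    then show ?thesis using assms Cons by (simp add: rcons_reduced)
  qed (simp add: Cons)
qed simp

text \<open>An adjacent inverse pair acts trivially on \<open>S\<close>, so cancelling it does not
  change the action. This yields associativity in the word group and makes the shift action below
  compatible with its product.\<close>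

lemma foldr_free_reduce:
  assumes closed: "\<And>p z. z \<in> S \<Longrightarrow> act p z \<in> S"
    and cancel: "\<And>x b z. z \<in> S \<Longrightarrow> act (x, \<not> b) (act (x, b) z) = z"
    and z: "z \<in> S"
  shows "foldr act (free_reduce w) z = foldr act w z"
proof -
  have rc: "foldr act (rcons p u) z = act p (foldr act u z)" for p u
  proof (cases u)
    case (Cons q v)
    have "foldr act v z \<in> S" using z closed by (induction v) auto
    with cancel[of "foldr act v z" "fst p" "\<not> snd p"] show ?thesis
      by (simp add: Cons)
  qed simp
  show ?thesis
    by (induction w) (auto simp: free_reduce_def rc)
qed

lemma foldr_rcons_free_reduce:
  "gword_reduced z \<Longrightarrow> foldr rcons (free_reduce w) z = foldr rcons w z"
  by (rule foldr_free_reduce[where S = "Collect gword_reduced"])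
    (auto simp: gword_reduced_rcons rcons_cancel)

definition word_group :: "'x set \<Rightarrow> 'x gword monoid" where
  "word_group X =
     \<lparr>carrier = {w \<in> gwords X. gword_reduced w}, mult = foldr rcons, one = []\<rparr>"

lemma word_group_simps [simp]:
  "w \<in> carrier (word_group X) \<longleftrightarrow> w \<in> gwords X \<and> gword_reduced w"
  "u \<otimes>\<^bsub>word_group X\<^esub> v = foldr rcons u v"
  "\<one>\<^bsub>word_group X\<^esub> = []"
  by (simp_all add: word_group_def)

text \<open>Associativity is read off from the action on reduced words: both bracketings are the
  action of the concatenation \<open>u @ v\<close> on \<open>w\<close>.\<close>

lemma group_word_group: "group (word_group X)"
proof (rule groupI)
  fix u v w
  assume "u \<in> carrier (word_group X)" "v \<in> carrier (word_group X)" "w \<in> carrier (word_group X)"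
  then have red: "gword_reduced v" "gword_reduced w" by auto
  then have "foldr rcons u v = free_reduce (u @ v)"
    using foldr_rcons_reduced[of v "[]"] by (simp add: free_reduce_def)
  then show "u \<otimes>\<^bsub>word_group X\<^esub> v \<otimes>\<^bsub>word_group X\<^esub> w =
      u \<otimes>\<^bsub>word_group X\<^esub> (v \<otimes>\<^bsub>word_group X\<^esub> w)"
    using red by (simp add: foldr_rcons_free_reduce)
next
  fix u assume u: "u \<in> carrier (word_group X)"
  let ?i = "map (\<lambda>(x, b). (x, \<not> b)) (rev u)"
  have "foldr rcons ?i u = []"
    using u
  proof (induction u)
    case (Cons p u)
    then have red: "gword_reduced u" and "rcons p u = p # u"
      by (auto simp: gword_reduced_Cons rcons_reduced)
    then have "rcons (fst p, \<not> snd p) (p # u) = u"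
      using rcons_cancel[OF red, of "fst p" "snd p"] by simp
    with Cons show ?case by (auto simp: gword_reduced_Cons split_beta)
  qed simp
  moreover have "?i \<in> gwords X" using u by (auto simp: gwords_def)
  \<comment> \<open>Passing the formal inverse through \<open>free_reduce\<close> makes its
    membership in the carrier immediate.\<close>
  ultimately show "\<exists>v\<in>carrier (word_group X). v \<otimes>\<^bsub>word_group X\<^esub> u = \<one>\<^bsub>word_group X\<^esub>"
    using u
    by (intro bexI[of _ "free_reduce ?i"])
       (auto simp: foldr_rcons_free_reduce free_reduce_gwords gword_reduced_free_reduce)
qed (auto simp: foldr_rcons_gwords gword_reduced_foldr_rcons foldr_rcons_reduced)

lemma word_group_inv_letter:
  "x \<in> X \<Longrightarrow> inv\<^bsub>word_group X\<^esub> [(x, True)] = [(x, False)]"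
  by (rule group.inv_equality[OF group_word_group]) (auto simp: gword_reduced_Cons)

lemma gword_val_word_group:
  "w \<in> gwords X \<Longrightarrow> gword_val (word_group X) (\<lambda>x. [(x, True)]) w = free_reduce w"
  by (induction w) (auto simp: word_group_inv_letter free_reduce_def)

section \<open>Evaluation of words in an arbitrary group\<close>

lemma (in group) gword_val_rcons:
  assumes f: "f ` X \<subseteq> carrier G" and p: "fst p \<in> X" and w: "w \<in> gwords X"
  shows "gword_val G f (rcons p w) = gword_val G f (p # w)"
proof (cases w)
  case (Cons q v)
  have "f (fst p) \<in> carrier G" using f p by auto
  then show ?thesis
    using Cons w gword_val_closed[OF f, of v]
    by (cases p; cases q) (auto simp: m_assoc[symmetric])
qed simp

lemma (in group) gword_val_foldr_rcons:
  assumes f: "f ` X \<subseteq> carrier G" and "u \<in> gwords X" "v \<in> gwords X"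
  shows "gword_val G f (foldr rcons u v) = gword_val G f u \<otimes> gword_val G f v"
  using assms(2)
proof (induction u)
  case Nil
  then show ?case using assms by (simp add: gword_val_closed[OF f])
next
  case (Cons p u)
  have "f (fst p) \<in> carrier G" using f Cons.prems by auto
  then show ?case
    using Cons gword_val_rcons[OF f, of p "foldr rcons u v"] assms
      gword_val_closed[OF f]
    by (cases p) (auto simp: foldr_rcons_gwords m_assoc)
qed

lemma (in group) gword_val_free_reduce:
  "f ` X \<subseteq> carrier G \<Longrightarrow> w \<in> gwords X \<Longrightarrow> gword_val G f (free_reduce w) = gword_val G f w"
  unfolding free_reduce_def
  by (subst gword_val_foldr_rcons[of f X]) (auto simp: gword_val_closed)

lemma (in group) gword_val_hom:
  "f ` X \<subseteq> carrier G \<Longrightarrow> gword_val G f \<in> hom (word_group X) G"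
  by (rule homI) (auto simp: gword_val_closed gword_val_foldr_rcons)

lemma gword_val_cong:
  "w \<in> gwords X \<Longrightarrow> (\<And>x. x \<in> X \<Longrightarrow> f x = g x) \<Longrightarrow> gword_val G f w = gword_val G g w"
  by (induction w) auto

lemma gword_val_reindex:
  "gword_val G f (map (map_prod \<sigma> id) w) = gword_val G (f \<circ> \<sigma>) w"
  by (induction w) auto

lemma (in group_hom) hom_gword_val:
  assumes f: "f ` X \<subseteq> carrier G" and w: "w \<in> gwords X"
  shows "h (gword_val G f w) = gword_val H (h \<circ> f) w"
  using w
proof (induction w)
  case (Cons p w)
  have "f (fst p) \<in> carrier G" using f Cons.prems by auto
  then show ?case
    using Cons G.gword_val_closed[OF f] by (cases p) auto
qed simp

text \<open>Inverses in the group with restricted carrier are a priori different from those in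
  \<open>G\<close>; on a subgroup they agree. This matters because \<phi> is a homomorphism on
  \<open>F'\<close> with its own group structure.\<close>

lemma gword_val_restrict_carrier:
  assumes G: "group G" and H: "subgroup H G" and f: "f ` X \<subseteq> H" and w: "w \<in> gwords X"
  shows "gword_val (G\<lparr>carrier := H\<rparr>) f w = gword_val G f w"
  using w
proof (induction w)
  case (Cons p w)
  interpret group G by fact
  have "f (fst p) \<in> H" using Cons.prems f by auto
  then show ?case using Cons m_inv_consistent[OF H] by (cases p) auto
qed simp

lemma (in group) generate_eq_gword_val:
  assumes f: "f ` X \<subseteq> carrier G"
  shows "generate G (f ` X) = gword_val G f ` gwords X"
proof
  show "generate G (f ` X) \<subseteq> gword_val G f ` gwords X"
  proof
    fix g assume "g \<in> generate G (f ` X)"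
    then show "g \<in> gword_val G f ` gwords X"
    proof induction
      case one
      show ?case by (rule image_eqI[of _ _ "[]"]) auto
    next
      case (incl h)
      then obtain x where x: "x \<in> X" "h = f x" by auto
      then show ?case using f by (intro image_eqI[of _ _ "[(x, True)]"]) auto
    next
      case (inv h)
      then obtain x where x: "x \<in> X" "h = f x" by auto
      then show ?case using f by (intro image_eqI[of _ _ "[(x, False)]"]) auto
    next
      case (eng h1 h2)
      then obtain u v where "u \<in> gwords X" "v \<in> gwords X"
        "h1 = gword_val G f u" "h2 = gword_val G f v" by auto
      then show ?case by (intro image_eqI[of _ _ "u @ v"]) (auto simp: gword_val_append[OF f])
    qed
  qed
  have "gword_val G f w \<in> generate G (f ` X)" if "w \<in> gwords X" for w
    using that
  proof (induction w)
    case (Cons p w)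
    then show ?case
      by (cases p) (auto intro!: generate.eng intro: generate.incl generate.inv)
  qed (auto intro: generate.one)
  then show "gword_val G f ` gwords X \<subseteq> generate G (f ` X)" by auto
qed

section \<open>Free families\<close>

text \<open>Freeness is stated for an indexed family so that it includes distinctness of the
  members: if \<open>f x = f y\<close> with \<open>x \<noteq> y\<close>, then a reduced word of
  length two has value one.\<close>

definition free_family :: "('a, 'm) monoid_scheme \<Rightarrow> ('x \<Rightarrow> 'a) \<Rightarrow> 'x set \<Rightarrow> bool" where
  "free_family G f X \<longleftrightarrow> f ` X \<subseteq> carrier G \<and>
     (\<forall>w \<in> gwords X. gword_reduced w \<longrightarrow> gword_val G f w = \<one>\<^bsub>G\<^esub> \<longrightarrow> w = [])"

lemma gwords_mono: "X \<subseteq> Y \<Longrightarrow> gwords X \<subseteq> gwords Y"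
  by (auto simp: gwords_def)

lemma free_family_mono: "free_family G f Y \<Longrightarrow> X \<subseteq> Y \<Longrightarrow> free_family G f X"
  using gwords_mono[of X Y] unfolding free_family_def by blast

lemma free_family_cong:
  assumes "free_family G f X" "\<And>x. x \<in> X \<Longrightarrow> f x = g x"
  shows "free_family G g X"
proof -
  have "gword_val G g w = gword_val G f w" if "w \<in> gwords X" for w
    using that assms(2) by (intro gword_val_cong[of w X]) auto
  then show ?thesis
    using assms by (auto simp: free_family_def)
qed

lemma (in group) free_family_mon:
  assumes "free_family G f X"
  shows "gword_val G f \<in> mon (word_group X) G"
proof -
  interpret W: group_hom "word_group X" G "gword_val G f"
    using assms group_word_group is_group gword_val_hom
    by (auto simp: group_hom_def group_hom_axioms_def free_family_def)
  have "inj_on (gword_val G f) (carrier (word_group X))"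
    using assms unfolding W.inj_on_one_iff by (auto simp: free_family_def)
  with W.homh show ?thesis by (simp add: mon_def)
qed

lemma (in group) free_family_eq_one:
  assumes "free_family G f X" "w \<in> gwords X" "gword_val G f w = \<one>"
  shows "free_reduce w = []"
  using assms gword_val_free_reduce[of f X w] free_reduce_gwords[of w X]
    gword_reduced_free_reduce[of w]
  by (simp add: free_family_def)

lemma free_family_comp_mon:
  assumes "group G" "group H" "h \<in> mon G H" "free_family G f X"
  shows "free_family H (h \<circ> f) X"
proof -
  interpret h: group_hom G H h
    using assms by (simp add: group_hom_def group_hom_axioms_def mon_def)
  have f: "f ` X \<subseteq> carrier G" using assms by (simp add: free_family_def)
  have "w = []" if w: "w \<in> gwords X" "gword_reduced w" and "gword_val H (h \<circ> f) w = \<one>\<^bsub>H\<^esub>" for w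
  proof -
    have "h (gword_val G f w) = h \<one>\<^bsub>G\<^esub>" using that h.hom_gword_val[OF f] by simp
    then have "gword_val G f w = \<one>\<^bsub>G\<^esub>"
      using assms(3) h.G.gword_val_closed[OF f w(1)]
      by (intro inj_onD[of h "carrier G"]) (simp_all add: mon_def)
    then show ?thesis using assms(4) w by (simp add: free_family_def)
  qed
  then show ?thesis using f by (auto simp: free_family_def)
qed

lemma gword_reduced_map:
  assumes "inj_on \<sigma> X"
  shows "w \<in> gwords X \<Longrightarrow> gword_reduced w \<Longrightarrow> gword_reduced (map (map_prod \<sigma> id) w)"
proof (induction w)
  case (Cons p w)
  then show ?case
    using assms by (cases w) (auto simp: gword_reduced_Cons prod_eq_iff inj_on_eq_iff)
qed simp

lemma free_family_reindex:
  assumes "free_family G f Y" "inj_on \<sigma> X" "\<sigma> ` X \<subseteq> Y"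
  shows "free_family G (f \<circ> \<sigma>) X"
proof -
  have gw: "map (map_prod \<sigma> id) w \<in> gwords Y" if "w \<in> gwords X" for w
    using that assms(3) by (induction w) auto
  show ?thesis
    unfolding free_family_def
  proof (intro conjI ballI impI)
    fix w assume w: "w \<in> gwords X" "gword_reduced w" "gword_val G (f \<circ> \<sigma>) w = \<one>\<^bsub>G\<^esub>"
    then have "map (map_prod \<sigma> id) w = []"
      using assms(1) gw[OF w(1)] gword_reduced_map[OF assms(2) w(1,2)] w(3)
      unfolding free_family_def gword_val_reindex[symmetric] by blast
    then show "w = []" by simp
  qed (use assms in \<open>auto simp: free_family_def\<close>)
qed

lemma free_family_letters:
  assumes "X \<subseteq> Y"
  shows "free_family (word_group Y) (\<lambda>x. [(x, True)]) X"
  unfolding free_family_def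
proof (intro conjI ballI impI)
  fix w assume "w \<in> gwords X" "gword_reduced w"
    and "gword_val (word_group Y) (\<lambda>x. [(x, True)]) w = \<one>\<^bsub>word_group Y\<^esub>"
  then show "w = []"
    using gwords_mono[OF assms] by (simp add: subset_iff gword_val_word_group free_reduce_reduced)
qed (use assms in \<open>auto simp: gword_reduced_Cons\<close>)

lemma mon_word_group_inclusion:
  "X \<subseteq> Y \<Longrightarrow> id \<in> mon (word_group X) (word_group Y)"
  using gwords_mono[of X Y] by (auto simp: mon_def hom_def)

lemma gword_val_word_group_mono:
  assumes Z: "Z \<subseteq> Z'" and f: "f ` X \<subseteq> carrier (word_group Z)" and w: "w \<in> gwords X"
  shows "gword_val (word_group Z') f w = gword_val (word_group Z) f w"
proof -
  interpret i: group_hom "word_group Z" "word_group Z'" id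
    using mon_word_group_inclusion[OF Z]
    by (simp add: group_hom_def group_hom_axioms_def group_word_group mon_def)
  show ?thesis using i.hom_gword_val[OF f w] by simp
qed

lemma gword_val_word_group_closed:
  assumes "Z \<subseteq> Z'" "f ` X \<subseteq> carrier (word_group Z)" "w \<in> gwords X"
  shows "gword_val (word_group Z') f w \<in> carrier (word_group Z)"
  using group.gword_val_closed[OF group_word_group assms(2,3)]
  by (simp add: gword_val_word_group_mono[OF assms])

lemma free_family_word_group_mono:
  "X \<subseteq> Y \<Longrightarrow> free_family (word_group X) f Z \<Longrightarrow> free_family (word_group Y) f Z"
  using free_family_comp_mon[OF group_word_group group_word_group mon_word_group_inclusion]
  by (metis id_comp)

text \<open>A word involves only finitely many letters. This will reduce orbits with unbounded
  exponents to bounded ones.\<close>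

lemma free_family_finite_subsets:
  assumes "\<And>Y. finite Y \<Longrightarrow> Y \<subseteq> X \<Longrightarrow> free_family G f Y"
  shows "free_family G f X"
  unfolding free_family_def
proof (intro conjI ballI impI)
  show "f ` X \<subseteq> carrier G"
    using assms[of "{_}"] by (auto simp: free_family_def)
  fix w assume w: "w \<in> gwords X" "gword_reduced w" "gword_val G f w = \<one>\<^bsub>G\<^esub>"
  have "w \<in> gwords (fst ` set w)" by (force simp: gwords_def)
  moreover have "fst ` set w \<subseteq> X" using w(1) by (auto simp: gwords_def)
  ultimately show "w = []"
    using assms[of "fst ` set w"] w by (simp add: free_family_def)
qed

text \<open>A reduced word splits into monochromatic syllables, and the values of consecutive
  syllables cannot cancel because their letters have different colours.\<close>

lemma free_family_coloured:
  fixes c :: "'x \<Rightarrow> 'c" and d :: "'z \<Rightarrow> 'c"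
  assumes f: "\<And>x. x \<in> X \<Longrightarrow> f x \<in> carrier (word_group {z \<in> Z. d z = c x})"
    and free: "\<And>k. free_family (word_group Z) f {x \<in> X. c x = k}"
  shows "free_family (word_group Z) f X"
proof -
  interpret W: group "word_group Z" by (rule group_word_group)
  let ?v = "gword_val (word_group Z) f"
  have fZ: "f ` X \<subseteq> carrier (word_group Z)"
    using f gwords_mono[of "{z \<in> Z. d z = c _}" Z] by fastforce
  have mono_val: "?v w \<in> gwords {z \<in> Z. d z = k}" if "w \<in> gwords {x \<in> X. c x = k}" for w k
  proof -
    have "f ` {x \<in> X. c x = k} \<subseteq> carrier (word_group {z \<in> Z. d z = k})"
      using f by auto
    from gword_val_word_group_closed[OF _ this that, of Z] show ?thesis by simp
  qed
  \<comment> \<open>The induction also records the colour of the first letter of the value; this is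
    what rules out cancellation with the preceding syllable.\<close>
  have main: "?v w \<noteq> [] \<and> d (fst (hd (?v w))) = c (fst (hd w))"
    if "w \<in> gwords X" "gword_reduced w" "w \<noteq> []" for w
    using that
  proof (induction "length w" arbitrary: w rule: less_induct)
    case less
    let ?k = "c (fst (hd w))"
    let ?P = "\<lambda>p. c (fst p) = ?k"
    define s where "s = takeWhile ?P w"
    define r where "r = dropWhile ?P w"
    have w: "w = s @ r" by (simp add: s_def r_def)
    have s0: "s \<noteq> []" using less.prems by (cases w) (auto simp: s_def)
    have red: "gword_reduced s" "gword_reduced r" and gw: "s \<in> gwords X" "r \<in> gwords X"
      using less.prems unfolding w by (auto simp: gword_reduced_append)
    have "\<forall>p \<in> set s. ?P p" by (auto simp: s_def dest: set_takeWhileD)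
    with gw have sk: "s \<in> gwords {x \<in> X. c x = ?k}"
      by (auto simp: gwords_def)
    have vs: "?v s \<noteq> []" "?v s \<in> gwords {z \<in> Z. d z = ?k}"
      using free[of ?k] sk red s0 mono_val[OF sk] by (auto simp: free_family_def)
    have val: "?v w = foldr rcons (?v s) (?v r)"
      using W.gword_val_append[OF fZ gw] by (simp add: w)
    have cl: "?v s \<in> carrier (word_group Z)" "?v r \<in> carrier (word_group Z)"
      using W.gword_val_closed[OF fZ] gw by blast+
    have "gword_reduced (?v s @ ?v r)"
    proof (cases "r = []")
      case True
      then show ?thesis using cl by simp
    next
      case False
      have "length r < length w" using s0 by (simp add: w)
      then have "d (fst (hd (?v r))) = c (fst (hd r))"
        using less.hyps[of r] gw red False by simp
      also have "\<dots> \<noteq> ?k"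
        using False hd_dropWhile[of ?P w] by (simp add: r_def)
      also have "d (fst (last (?v s))) = ?k"
        using vs(2) last_in_set[OF vs(1)] by (auto simp: gwords_def)
      then have "?k = d (fst (last (?v s)))" ..
      finally have "hd (?v r) \<noteq> (fst (last (?v s)), \<not> snd (last (?v s)))" by auto
      then show ?thesis using cl by (simp add: gword_reduced_append)
    qed
    then have "?v w = ?v s @ ?v r" using val by (simp add: foldr_rcons_reduced)
    then show ?case
      using vs by (cases "?v s") auto
  qed
  show ?thesis
    using fZ main by (auto simp: free_family_def)
qed

section \<open>Free conjugates in a free group of rank two\<close>

definition conj_word :: "'x \<Rightarrow> 'x \<Rightarrow> nat \<Rightarrow> 'x gword" where
  "conj_word x y i = replicate i (x, True) @ (y, True) # replicate i (x, False)"

lemma conj_word_closed: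
  assumes "x \<noteq> y"
  shows "conj_word x y i \<in> carrier (word_group {x, y})"
proof -
  have "gword_reduced (replicate i (x, b))" for b
    by (induction i) (auto simp: gword_reduced_Cons)
  moreover have "replicate i (x, b) \<in> gwords {x, y}" for b
    by (induction i) auto
  ultimately show ?thesis
    using assms
    by (cases "i = 0") (auto simp: conj_word_def gword_reduced_append gword_reduced_Cons)
qed

text \<open>Let \<open>x\<close> act on the reduced words over \<open>\<int>\<close> by shifting all indices and \<open>y\<close> by left
  multiplication with the letter \<open>0\<close>; then \<open>x\<^sup>i y x\<^sup>-\<^sup>i\<close> acts by left multiplication with the
  letter \<open>i\<close>.\<close>

definition shift_word :: "int \<Rightarrow> int gword \<Rightarrow> int gword" where
  "shift_word k = map (map_prod (\<lambda>i. i + k) id)"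

lemma shift_word_add: "shift_word k (shift_word l w) = shift_word (l + k) w"
  by (auto simp: shift_word_def add.assoc)

lemma shift_word_0 [simp]: "shift_word 0 w = w"
  by (auto simp: shift_word_def intro: map_idI)

lemma gword_reduced_shift_word: "gword_reduced w \<Longrightarrow> gword_reduced (shift_word k w)"
  unfolding shift_word_def
  by (rule gword_reduced_map[of _ UNIV]) (auto simp: gwords_def inj_on_def)

lemma shift_word_rcons: "shift_word k (rcons (i, b) w) = rcons (i + k, b) (shift_word k w)"
  by (cases w) (auto simp: shift_word_def prod_eq_iff)

definition shift_act :: "'x \<Rightarrow> 'x \<times> bool \<Rightarrow> int gword \<Rightarrow> int gword" where
  "shift_act x p =
     (if fst p = x then shift_word (if snd p then 1 else - 1) else rcons (0, snd p))"

lemma shift_act_replicate: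
  "foldr (shift_act x) (replicate i (x, b)) w = shift_word (if b then int i else - int i) w"
  by (induction i) (auto simp: shift_act_def shift_word_add add.commute)

lemma shift_act_conj_word:
  assumes "x \<noteq> y"
  shows "foldr (shift_act x) (conj_word x y i) w = rcons (int i, True) w"
  using assms
  by (simp add: conj_word_def shift_act_replicate shift_word_rcons shift_word_add
      shift_act_def[of _ "(y, True)"] del: foldr_replicate)

lemma gword_reduced_shift_act: "gword_reduced w \<Longrightarrow> gword_reduced (shift_act x p w)"
  by (simp add: shift_act_def gword_reduced_shift_word gword_reduced_rcons)

text \<open>Opposite letters act by mutually inverse maps on reduced words, every letter other than
  \<open>x\<close> being treated as \<open>y\<close>. Hence reducing the concatenation
  \<open>u @ v\<close> leaves its action unchanged.\<close>

lemma shift_act_mult: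
  assumes "gword_reduced v" "gword_reduced w"
  shows "foldr (shift_act x) (foldr rcons u v) w = foldr (shift_act x) u (foldr (shift_act x) v w)"
proof -
  have "foldr rcons u v = free_reduce (u @ v)"
    using foldr_rcons_reduced[of v "[]"] assms by (simp add: free_reduce_def)
  moreover have "foldr (shift_act x) (free_reduce (u @ v)) w = foldr (shift_act x) (u @ v) w"
    using assms
    by (intro foldr_free_reduce[where S = "Collect gword_reduced"])
       (auto simp: gword_reduced_shift_word gword_reduced_rcons shift_act_def shift_word_add
          rcons_cancel rcons_cancel[where b = False, simplified])
  ultimately show ?thesis by simp
qed

text \<open>Acting on the empty word, the product of conjugates prescribed by \<open>w\<close>
  spells out the free reduction of \<open>w\<close> with its indices read as integers. If the
  product is trivial, this reduction is empty, hence so is the reduced word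
  \<open>w\<close>.\<close>

lemma free_family_conj_word:
  assumes "x \<noteq> y"
  shows "free_family (word_group {x, y}) (conj_word x y) UNIV"
proof -
  let ?W = "word_group {x, y}" and ?a = "shift_act x"
  interpret W: group ?W by (rule group_word_group)
  let ?f = "conj_word x y"
  have f: "?f i \<in> carrier ?W" for i by (rule conj_word_closed[OF assms])
  \<comment> \<open>The inverse is never computed as a word: its action is deduced from
    \<open>W.l_inv\<close> at \<open>rcons (int i, False) u\<close>, which the conjugate sends to
    \<open>u\<close>.\<close>
  have inv: "foldr ?a (inv\<^bsub>?W\<^esub> (?f i)) u = rcons (int i, False) u" if u: "gword_reduced u" for i u
  proof -
    let ?u = "rcons (int i, False) u"
    have u': "gword_reduced ?u" using u by (rule gword_reduced_rcons)
    have "foldr ?a (inv\<^bsub>?W\<^esub> (?f i)) (foldr ?a (?f i) ?u) = ?u"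
      using W.l_inv[OF f[of i]] f[of i] shift_act_mult[of "?f i" ?u x "inv\<^bsub>?W\<^esub> (?f i)"] u' by simp
    then show ?thesis
      using rcons_cancel[OF u, of "int i" False] by (simp add: shift_act_conj_word[OF assms])
  qed
  have act: "foldr ?a (gword_val ?W ?f w) u = foldr rcons (map (map_prod int id) w) u"
    if "gword_reduced u" for w u
  proof (induction w)
    case (Cons p w)
    obtain i b where p: "p = (i, b)" by fastforce
    have "gword_val ?W ?f w \<in> carrier ?W"
      using f by (intro W.gword_val_closed[of _ UNIV]) (auto simp: gwords_def)
    then have red: "gword_reduced (gword_val ?W ?f w)" by simp
    show ?case
      using Cons that inv gword_reduced_foldr_rcons[OF that]
      by (simp add: p shift_act_mult[OF red that] shift_act_conj_word[OF assms])
  qed simp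
  show ?thesis
    unfolding free_family_def
  proof (intro conjI ballI impI)
    fix w :: "nat gword" assume w: "w \<in> gwords UNIV" "gword_reduced w" "gword_val ?W ?f w = \<one>\<^bsub>?W\<^esub>"
    have "free_reduce (map (map_prod int id) w) = []"
      using act[of "[]" w] w by (simp add: free_reduce_def)
    moreover have "gword_reduced (map (map_prod int id) w)"
      using w by (intro gword_reduced_map[of _ UNIV]) auto
    ultimately show "w = []" by (simp add: free_reduce_reduced)
  qed (use f in auto)
qed

section \<open>Free bases\<close>

lemma free_basis_iso:
  assumes "group G" "free_basis G B"
  shows "gword_val G id \<in> iso (word_group B) G"
proof -
  interpret group G by fact
  show ?thesis
    using assms(2) gword_val_hom[of id B] by (simp add: iso_def free_basis_def word_group_def)
qed

lemma free_basis_free_family: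
  assumes "group G" "free_basis G B"
  shows "free_family G id B"
proof -
  interpret i: group_hom "word_group B" G "gword_val G id"
    using free_basis_iso[OF assms] assms(1) group_word_group
    by (auto simp: group_hom_def group_hom_axioms_def iso_def)
  have "inj_on (gword_val G id) (carrier (word_group B))"
    using free_basis_iso[OF assms] by (simp add: iso_def bij_betw_def)
  then show ?thesis
    using assms(2) unfolding i.inj_on_one_iff by (auto simp: free_family_def free_basis_def)
qed

text \<open>Finitely many generators involve only a finite set \<open>B0\<close> of basis elements.
  Any further basis element would be the value of a word over \<open>B0\<close> and hence have two
  reduced expressions.\<close>

lemma free_basis_finite:
  assumes "group G" "free_basis G B" "finitely_generated_group G"
  shows "finite B"
proof -
  interpret group G by fact
  let ?v = "gword_val G id" and ?W = "{w \<in> gwords B. gword_reduced w}"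
  have bij: "bij_betw ?v ?W (carrier G)" and B: "B \<subseteq> carrier G"
    using assms(2) by (auto simp: free_basis_def)
  obtain S where S: "finite S" "S \<subseteq> carrier G" "generate G S = carrier G"
    using assms(3) by (auto simp: finitely_generated_group_def)
  define wd where "wd = inv_into ?W ?v"
  have wd: "wd g \<in> ?W" "?v (wd g) = g" if "g \<in> carrier G" for g
  proof -
    have g: "g \<in> ?v ` ?W" using that bij by (simp add: bij_betw_def)
    show "wd g \<in> ?W" "?v (wd g) = g"
      unfolding wd_def by (rule inv_into_into[OF g], rule f_inv_into_f[OF g])
  qed
  define B0 where "B0 = (\<Union>s\<in>S. fst ` set (wd s))"
  have letters: "fst ` set w \<subseteq> X \<longleftrightarrow> w \<in> gwords X" for w :: "'a gword" and X
    by (induction w) auto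
  have B0: "B0 \<subseteq> B" using wd(1) S(2) unfolding B0_def UN_subset_iff letters by blast
  have B0c: "id ` B0 \<subseteq> carrier G" using B0 B by auto
  have "S \<subseteq> generate G (id ` B0)"
  proof
    fix s assume s: "s \<in> S"
    then have "wd s \<in> gwords B0" unfolding letters[symmetric] B0_def by blast
    then have "?v (wd s) \<in> generate G (id ` B0)" unfolding generate_eq_gword_val[OF B0c] by auto
    then show "s \<in> generate G (id ` B0)" using wd(2)[of s] s S(2) by (metis subsetD)
  qed
  then have gen: "carrier G \<subseteq> gword_val G id ` gwords B0"
    using S(3) generate_subgroup_incl[OF _ generate_is_subgroup[OF B0c]]
    unfolding generate_eq_gword_val[OF B0c] by metis
  have "B \<subseteq> B0"
  proof
    fix b assume b: "b \<in> B"
    then obtain w where w: "w \<in> gwords B0" "b = ?v w" using gen B by blast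
    have "free_reduce w \<in> ?W" "free_reduce w \<in> gwords B0"
      using free_reduce_gwords[OF w(1)] gwords_mono[OF B0] gword_reduced_free_reduce[of w] by auto
    moreover have "?v (free_reduce w) = ?v [(b, True)]"
      using w(2) b B gword_val_free_reduce[OF B0c w(1)] by (simp add: subset_iff)
    moreover have "[(b, True)] \<in> ?W" using b by (simp add: gword_reduced_Cons)
    ultimately have "free_reduce w = [(b, True)]"
      using bij by (meson bij_betw_imp_inj_on inj_onD)
    then show "b \<in> B0" using \<open>free_reduce w \<in> gwords B0\<close> by simp
  qed
  moreover have "finite B0" using S(1) by (auto simp: B0_def)
  ultimately show ?thesis by (rule finite_subset)
qed

lemma word_group_generate:
  "generate (word_group X) ((\<lambda>x. [(x, True)]) ` X) = carrier (word_group X)"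
proof -
  interpret group "word_group X" by (rule group_word_group)
  have l: "(\<lambda>x. [(x, True)]) ` X \<subseteq> carrier (word_group X)" by (auto simp: gword_reduced_Cons)
  have "free_reduce ` gwords X = carrier (word_group X)"
    by (force simp: free_reduce_gwords gword_reduced_free_reduce free_reduce_reduced image_iff)
  then show ?thesis
    unfolding generate_eq_gword_val[OF l] by (simp add: gword_val_word_group cong: image_cong)
qed

lemma finitely_generated_word_group: "finite X \<Longrightarrow> finitely_generated_group (word_group X)"
  unfolding finitely_generated_group_def
  by (intro exI[of _ "(\<lambda>x. [(x, True)]) ` X"]) (auto simp: word_group_generate gword_reduced_Cons)

lemma is_free_group_word_group: "is_free_group (word_group X)"
proof -
  let ?l = "\<lambda>x. [(x, True)]" and ?W = "word_group X"
  interpret group ?W by (rule group_word_group)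
  let ?B = "?l ` X"
  have B: "?B \<subseteq> carrier ?W" by (auto simp: gword_reduced_Cons)
  \<comment> \<open>Since \<open>fst (hd w)\<close> recovers the letter from a one-letter word, the
    basis of one-letter words is a relabelling of the family of letters.\<close>
  have "free_family ?W (?l \<circ> (\<lambda>w. fst (hd w))) ?B"
    by (rule free_family_reindex[OF free_family_letters[of X X]]) (auto simp: inj_on_def)
  then have ff: "free_family ?W id ?B"
    by (rule free_family_cong) auto
  have "gword_val ?W id ` {w \<in> gwords ?B. gword_reduced w} = carrier ?W"
  proof -
    have "gword_val ?W id ` {w \<in> gwords ?B. gword_reduced w} = gword_val ?W id ` gwords ?B"
      using gword_val_free_reduce[of id ?B] B
      by (auto simp: image_iff)
        (metis free_reduce_gwords gword_reduced_free_reduce)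
    then show ?thesis
      using generate_eq_gword_val[of id ?B] B word_group_generate[of X] by simp
  qed
  then have "free_basis ?W ?B"
    using free_family_mon[OF ff] B
    by (auto simp: free_basis_def bij_betw_def mon_def word_group_def)
  then show ?thesis using is_group by (auto simp: is_free_group_def)
qed

section \<open>The base of an ascending HNN extension\<close>

lemma (in group) right_transversal_exists:
  assumes H: "subgroup H G"
  obtains T where "T \<subseteq> carrier G" "\<And>g. g \<in> carrier G \<Longrightarrow> \<exists>h\<in>H. \<exists>\<tau>\<in>T. g = h \<otimes> \<tau>"
    "\<And>h h' \<tau> \<tau>'. h \<in> H \<Longrightarrow> h' \<in> H \<Longrightarrow> \<tau> \<in> T \<Longrightarrow> \<tau>' \<in> T \<Longrightarrow> h \<otimes> \<tau> = h' \<otimes> \<tau>' \<Longrightarrow> h = h' \<and> \<tau> = \<tau>'"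
proof
  interpret H: subgroup H G by fact
  \<comment> \<open>The choice refers to the coset alone, so equal cosets have the same
    representative.\<close>
  define rep where "rep g = (SOME x. x \<in> H #> g)" for g
  have rep: "rep g \<in> H #> g" if "g \<in> carrier G" for g
    using rcos_self[OF that H] by (auto simp: rep_def intro: someI)
  have rep_c: "rep g \<in> carrier G" if "g \<in> carrier G" for g
    using rep[OF that] r_coset_subset_G[OF H.subset that] by auto
  have rep_coset: "H #> rep g = H #> g" if "g \<in> carrier G" for g
    using repr_independence[OF rep[OF that] that H] by simp
  let ?T = "rep ` carrier G"
  show "?T \<subseteq> carrier G" using rep_c by auto
  show "\<exists>h\<in>H. \<exists>\<tau>\<in>?T. g = h \<otimes> \<tau>" if g: "g \<in> carrier G" for g
  proof -
    have "g \<in> H #> rep g" using rcos_self[OF g H] rep_coset[OF g] by simp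
    then show ?thesis using g by (auto simp: r_coset_def)
  qed
  fix h h' \<tau> \<tau>'
  assume h: "h \<in> H" "h' \<in> H" and \<tau>: "\<tau> \<in> ?T" "\<tau>' \<in> ?T" and eq: "h \<otimes> \<tau> = h' \<otimes> \<tau>'"
  have c: "\<tau> \<in> carrier G" "\<tau>' \<in> carrier G" using \<tau> rep_c by auto
  have "H #> \<tau> = H #> \<tau>'"
  proof -
    have "h \<otimes> \<tau> \<in> H #> \<tau>" "h \<otimes> \<tau> \<in> H #> \<tau>'" 
      using rcosI[OF h(1) H.subset c(1)] rcosI[OF h(2) H.subset c(2)] eq by simp_all
    then show ?thesis using repr_independence[OF _ _ H] c by metis
  qed
  then have "\<tau> = \<tau>'" using \<tau> rep_coset by (auto simp: rep_def)
  then show "h = h' \<and> \<tau> = \<tau>'" using eq c h by simp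
qed

text \<open>Let \<open>T\<close> be a right transversal of the image of \<open>\<Phi>\<close>. The base acts on
  \<open>E \<times> T\<^sup>\<nat>\<close> by left multiplication on the first factor, and the stable letter acts by
  \<open>(y, \<sigma>) \<mapsto> (\<Phi> y \<cdot> \<sigma> 0, \<lambda>i. \<sigma> (i + 1))\<close>, which is bijective because every element of \<open>E\<close> is
  uniquely of the form \<open>\<Phi> y \<cdot> \<tau>\<close>.\<close>

lemma inj_on_ascending_hnn_base:
  assumes E: "group E" and \<Phi>: "\<Phi> \<in> mon E E"
  shows "inj_on (hnn_base E (carrier E) \<Phi>) (carrier E)"
proof -
  interpret E: group E by fact
  interpret \<Phi>: group_hom E E \<Phi> using \<Phi> by unfold_locales (simp add: mon_def)
  have \<Phi>_inj: "inj_on \<Phi> (carrier E)" using \<Phi> by (simp add: mon_def)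
  obtain T where T: "T \<subseteq> carrier E"
    and dec: "\<And>g. g \<in> carrier E \<Longrightarrow> \<exists>h\<in>\<Phi> ` carrier E. \<exists>\<tau>\<in>T. g = h \<otimes>\<^bsub>E\<^esub> \<tau>"
    and uniq: "\<And>h h' \<tau> \<tau>'. h \<in> \<Phi> ` carrier E \<Longrightarrow> h' \<in> \<Phi> ` carrier E \<Longrightarrow> \<tau> \<in> T \<Longrightarrow> \<tau>' \<in> T \<Longrightarrow>
      h \<otimes>\<^bsub>E\<^esub> \<tau> = h' \<otimes>\<^bsub>E\<^esub> \<tau>' \<Longrightarrow> h = h' \<and> \<tau> = \<tau>'"
    using E.right_transversal_exists[OF \<Phi>.img_is_subgroup] by blast
  define S where "S = carrier E \<times> {\<sigma> :: nat \<Rightarrow> 'a. \<forall>i. \<sigma> i \<in> T}"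
  \<comment> \<open>The maps in \<open>Bij S\<close> are \<open>undefined\<close> outside
    \<open>S\<close>, hence the restricted abstractions.\<close>
  define L where "L x = (\<lambda>(y, \<sigma>) \<in> S. (x \<otimes>\<^bsub>E\<^esub> y, \<sigma>))" for x
  define s where "s = (\<lambda>(y, \<sigma>) \<in> S. (\<Phi> y \<otimes>\<^bsub>E\<^esub> \<sigma> 0, \<lambda>i. \<sigma> (Suc i)))"
  have L: "L x (y, \<sigma>) = (x \<otimes>\<^bsub>E\<^esub> y, \<sigma>)" if "(y, \<sigma>) \<in> S" for x y \<sigma>
    using that by (simp add: L_def)
  have s: "s (y, \<sigma>) = (\<Phi> y \<otimes>\<^bsub>E\<^esub> \<sigma> 0, \<lambda>i. \<sigma> (Suc i))" if "(y, \<sigma>) \<in> S" for y \<sigma>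
    using that by (simp add: s_def)
  have L_Bij: "L x \<in> Bij S" if x: "x \<in> carrier E" for x
  proof -
    have "bij_betw (L x) S S"
    proof (rule bij_betw_byWitness[where f' = "L (inv\<^bsub>E\<^esub> x)"])
      show "\<forall>p\<in>S. L (inv\<^bsub>E\<^esub> x) (L x p) = p" "\<forall>p\<in>S. L x (L (inv\<^bsub>E\<^esub> x) p) = p"
        using x by (auto simp: L_def S_def E.m_assoc[symmetric])
    qed (use x in \<open>auto simp: L_def S_def\<close>)
    then show ?thesis by (simp add: Bij_def L_def)
  qed
  have "bij_betw s S S"
    unfolding bij_betw_def
  proof
    show "inj_on s S"
    proof (rule inj_onI)
      fix p q assume pq: "p \<in> S" "q \<in> S" "s p = s q"
      obtain y \<sigma> z \<rho> where p: "p = (y, \<sigma>)" and q: "q = (z, \<rho>)" by fastforce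
      have eq: "\<Phi> y \<otimes>\<^bsub>E\<^esub> \<sigma> 0 = \<Phi> z \<otimes>\<^bsub>E\<^esub> \<rho> 0" and Suc: "\<sigma> (Suc i) = \<rho> (Suc i)" for i
        using pq by (auto simp: p q s dest: fun_cong)
      have "\<Phi> y = \<Phi> z \<and> \<sigma> 0 = \<rho> 0"
        using pq by (intro uniq eq) (auto simp: p q S_def)
      then have "y = z" "\<sigma> 0 = \<rho> 0"
        using \<Phi>_inj pq by (auto simp: p q S_def inj_on_def)
      moreover have "\<sigma> = \<rho>"
      proof
        fix i show "\<sigma> i = \<rho> i" using Suc \<open>\<sigma> 0 = \<rho> 0\<close> by (cases i) auto
      qed
      ultimately show "p = q" by (simp add: p q)
    qed
    have "s ` S \<subseteq> S" using T by (auto simp: s_def S_def subset_iff)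
    moreover have "q \<in> s ` S" if "q \<in> S" for q
    proof -
      obtain z \<rho> where q: "q = (z, \<rho>)" by fastforce
      obtain y \<tau> where y: "y \<in> carrier E" "\<tau> \<in> T" "z = \<Phi> y \<otimes>\<^bsub>E\<^esub> \<tau>"
        using dec[of z] \<open>q \<in> S\<close> by (auto simp: q S_def)
      \<comment> \<open>Prepending the transversal part \<tau> of \<open>z\<close> to \<rho> undoes
        the shift.\<close>
      have mem: "(y, case_nat \<tau> \<rho>) \<in> S"
        using y \<open>q \<in> S\<close> by (auto simp: q S_def split: nat.split)
      show ?thesis by (rule image_eqI[OF _ mem]) (simp add: s[OF mem] q y)
    qed
    ultimately show "s ` S = S" by blast
  qed
  then have s_Bij: "s \<in> Bij S" by (simp add: Bij_def s_def)
  let ?K = "BijGroup S"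
  interpret K: group ?K by (rule group_BijGroup)
  have LK: "L x \<in> carrier ?K" if "x \<in> carrier E" for x
    using L_Bij[OF that] by (simp add: BijGroup_def)
  have sK: "s \<in> carrier ?K" using s_Bij by (simp add: BijGroup_def)
  have L_hom: "L \<in> hom E ?K"
  proof (rule homI)
    fix x y assume xy: "x \<in> carrier E" "y \<in> carrier E"
    then have "compose S (L x) (L y) = L (x \<otimes>\<^bsub>E\<^esub> y)"
      by (auto simp: compose_def L_def S_def E.m_assoc fun_eq_iff)
    then show "L (x \<otimes>\<^bsub>E\<^esub> y) = L x \<otimes>\<^bsub>?K\<^esub> L y"
      using xy L_Bij by (simp add: BijGroup_def)
  qed (rule LK)
  have conj: "s \<otimes>\<^bsub>?K\<^esub> L x \<otimes>\<^bsub>?K\<^esub> inv\<^bsub>?K\<^esub> s = L (\<Phi> x)" if x: "x \<in> carrier E" for x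
  proof -
    have "compose S s (L x) = compose S (L (\<Phi> x)) s"
      using x T by (auto simp: compose_def L_def s_def S_def E.m_assoc subset_iff fun_eq_iff)
    then have "s \<otimes>\<^bsub>?K\<^esub> L x = L (\<Phi> x) \<otimes>\<^bsub>?K\<^esub> s"
      using x L_Bij s_Bij by (simp add: BijGroup_def)
    then show ?thesis using LK[of "\<Phi> x"] sK x by (simp add: K.m_assoc)
  qed
  obtain \<theta> where \<theta>: "\<And>x. x \<in> carrier E \<Longrightarrow> \<theta> (hnn_base E (carrier E) \<Phi> x) = L x"
    using hnn_universal[OF K.is_group E L_hom sK subset_refl _ conj] \<Phi>.hom_closed
    by (metis image_subset_iff)
  show ?thesis
  proof (rule inj_onI)
    fix x y assume xy: "x \<in> carrier E" "y \<in> carrier E"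
      "hnn_base E (carrier E) \<Phi> x = hnn_base E (carrier E) \<Phi> y"
    then have "L x = L y" using \<theta> by metis
    \<comment> \<open>Evaluating the translations at a point with first coordinate one recovers
      \<open>x\<close> and \<open>y\<close>; such a point exists because \<open>T\<close> is
      nonempty.\<close>
    obtain \<tau> where "\<tau> \<in> T" using dec[of "\<one>\<^bsub>E\<^esub>"] by auto
    then have "(\<one>\<^bsub>E\<^esub>, \<lambda>_. \<tau>) \<in> S" by (simp add: S_def)
    then show "x = y" using L[of "\<one>\<^bsub>E\<^esub>" "\<lambda>_. \<tau>"] xy \<open>L x = L y\<close> by (metis E.r_one prod.inject)
  qed
qed

text \<open>This is the exponent sum of the stable letter. The relations are respected because the
  base goes to zero and the integers are abelian.\<close>

lemma hnn_exponent_hom: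
  assumes F: "group F" and H: "H \<subseteq> carrier F" "\<phi> ` H \<subseteq> carrier F"
  shows "\<exists>e \<in> hom (hnn F H \<phi>) integer_group.
    (\<forall>x\<in>carrier F. e (hnn_base F H \<phi> x) = 0) \<and> e (hnn_stable F H \<phi>) = 1"
  by (rule hnn_universal[OF group_integer_group F _ _ H]) (auto simp: hom_def)

section \<open>Normal forms in partial ascending HNN extensions\<close>

text \<open>Induction over words in the generators. The inverse of a base generator is the base
  image of an inverse, so one base case covers both signs; only the stable letter needs two
  cases.\<close>

lemma hnn_induct [consumes 2, case_names one base stable stable_inv]:
  assumes F: "group F" and g: "g \<in> carrier (hnn F H \<phi>)"
    and one: "P \<one>\<^bsub>hnn F H \<phi>\<^esub>"
    and base: "\<And>x g. x \<in> carrier F \<Longrightarrow> g \<in> carrier (hnn F H \<phi>) \<Longrightarrow> P g \<Longrightarrow>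
      P (hnn_base F H \<phi> x \<otimes>\<^bsub>hnn F H \<phi>\<^esub> g)"
    and stable: "\<And>g. g \<in> carrier (hnn F H \<phi>) \<Longrightarrow> P g \<Longrightarrow>
      P (hnn_stable F H \<phi> \<otimes>\<^bsub>hnn F H \<phi>\<^esub> g)"
    and stable_inv: "\<And>g. g \<in> carrier (hnn F H \<phi>) \<Longrightarrow> P g \<Longrightarrow>
      P (inv\<^bsub>hnn F H \<phi>\<^esub> (hnn_stable F H \<phi>) \<otimes>\<^bsub>hnn F H \<phi>\<^esub> g)"
  shows "P g"
proof -
  let ?X = "hnn_gens F" and ?R = "hnn_relators F H \<phi>" and ?G = "hnn F H \<phi>"
  let ?c = "pres_class ?X ?R"
  interpret F: group F by fact
  interpret G: group ?G by (rule group_hnn)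
  interpret \<beta>: group_hom F ?G "hnn_base F H \<phi>"
    by unfold_locales (rule hnn_base_hom[OF F])
  have cl: "?c w \<in> carrier ?G" if "w \<in> gwords ?X" for w
    using that by (auto simp: hnn_def carrier_presented_group)
  have mult: "?c (u @ v) = ?c u \<otimes>\<^bsub>?G\<^esub> ?c v" if "u \<in> gwords ?X" "v \<in> gwords ?X" for u v
    using that by (simp add: hnn_def mult_presented_group)
  have inv: "?c [(x, False)] = inv\<^bsub>?G\<^esub> (?c [(x, True)])" if x: "x \<in> ?X" for x
  proof (rule G.inv_equality[symmetric])
    show "?c [(x, False)] \<otimes>\<^bsub>?G\<^esub> ?c [(x, True)] = \<one>\<^bsub>?G\<^esub>"
      using pres_rel_inverse[of "[(x, True)]" ?X ?R] x
      by (simp add: hnn_def mult_presented_group one_presented_group pres_class_eq_iff)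
  qed (use x in \<open>auto intro: cl\<close>)
  have "P (?c w)" if "w \<in> gwords ?X" for w
    using that
  proof (induction w)
    case Nil
    then show ?case using one by (simp add: hnn_def one_presented_group)
  next
    case (Cons p w)
    obtain z b where p: "p = (z, b)" by fastforce
    have z: "z \<in> ?X" and w: "w \<in> gwords ?X" and IH: "P (?c w)" using Cons p by auto
    have eq: "?c (p # w) = ?c [(z, b)] \<otimes>\<^bsub>?G\<^esub> ?c w"
      using mult[of "[(z, b)]" w] z w by (simp add: p)
    show ?case
    proof (cases z)
      case None
      then have "?c [(z, b)] = (if b then hnn_stable F H \<phi> else inv\<^bsub>?G\<^esub> (hnn_stable F H \<phi>))"
        using inv[OF z] by (simp add: hnn_stable_def)
      then show ?thesis using stable stable_inv cl[OF w] IH by (simp add: eq)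
    next
      case (Some x)
      then have x: "x \<in> carrier F" using z by (auto simp: hnn_gens_def)
      have "?c [(z, b)] = hnn_base F H \<phi> (if b then x else inv\<^bsub>F\<^esub> x)"
        using inv[OF z] x by (simp add: Some hnn_base_def[symmetric])
      then show ?thesis using base[OF _ cl[OF w] IH] x by (simp add: eq)
    qed
  qed
  then show ?thesis using g by (auto simp: hnn_def carrier_presented_group)
qed

section \<open>Conjugation by an element and its powers\<close>

lemma (in group) l_cancel_inv:
  "x \<in> carrier G \<Longrightarrow> y \<in> carrier G \<Longrightarrow> inv x \<otimes> (x \<otimes> y) = y"
  by (simp add: m_assoc[symmetric])

lemma (in group) conj_mult:
  assumes "t \<in> carrier G" "a \<in> carrier G" "b \<in> carrier G"
  shows "t \<otimes> (a \<otimes> b) \<otimes> inv t = (t \<otimes> a \<otimes> inv t) \<otimes> (t \<otimes> b \<otimes> inv t)"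
  using assms by (simp add: m_assoc l_cancel_inv)

lemma (in group) conj_inv:
  "t \<in> carrier G \<Longrightarrow> a \<in> carrier G \<Longrightarrow> t \<otimes> inv a \<otimes> inv t = inv (t \<otimes> a \<otimes> inv t)"
  by (simp add: inv_mult_group m_assoc)

lemma (in group) conj_pow_Suc:
  "t \<in> carrier G \<Longrightarrow> a \<in> carrier G \<Longrightarrow>
     t [^] Suc n \<otimes> a \<otimes> inv (t [^] Suc n) = t \<otimes> (t [^] n \<otimes> a \<otimes> inv (t [^] n)) \<otimes> inv t"
  by (subst (1 2) nat_pow_Suc2) (simp_all add: inv_mult_group m_assoc)

text \<open>Conjugation by \<open>t\<close> is an endomorphism, so it suffices to check the
  generators.\<close>

lemma (in group) conj_generate:
  assumes t: "t \<in> carrier G" and S: "S \<subseteq> carrier G"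
    and conj: "\<And>a. a \<in> S \<Longrightarrow> t \<otimes> a \<otimes> inv t \<in> generate G S" and v: "v \<in> generate G S"
  shows "t \<otimes> v \<otimes> inv t \<in> generate G S"
  using v
proof induction
  case one
  then show ?case using t by (simp add: generate.one)
next
  case (incl h)
  then show ?case by (rule conj)
next
  case (inv h)
  then show ?case
    using t S conj[OF inv] generate_m_inv_closed[OF S] by (auto simp: conj_inv)
next
  case (eng a b)
  then show ?case
    using t generate_in_carrier[OF S] by (simp add: conj_mult generate.eng)
qed

text \<open>For \<open>b \<in> A\<close> the relations push \<open>t b t\<^sup>-\<^sup>1\<close> back into the base, so only the exponent
  \<open>0\<close> is needed.\<close>

definition orbit_index :: "'a set \<Rightarrow> 'a set \<Rightarrow> ('a \<times> nat) set" where
  "orbit_index B A = A \<times> {0} \<union> (B - A) \<times> UNIV"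

text \<open>For \<open>q = (b, i)\<close> this is the conjugate
  \<open>t\<^sup>i b t\<^sup>-\<^sup>i\<close>.\<close>

definition hnn_orbit ::
  "('a, 'm) monoid_scheme \<Rightarrow> 'a set \<Rightarrow> ('a \<Rightarrow> 'a) \<Rightarrow> 'a \<times> nat \<Rightarrow> 'a option gword set" where
  "hnn_orbit F H \<phi> q =
     hnn_stable F H \<phi> [^]\<^bsub>hnn F H \<phi>\<^esub> snd q \<otimes>\<^bsub>hnn F H \<phi>\<^esub> hnn_base F H \<phi> (fst q) \<otimes>\<^bsub>hnn F H \<phi>\<^esub>
     inv\<^bsub>hnn F H \<phi>\<^esub> (hnn_stable F H \<phi> [^]\<^bsub>hnn F H \<phi>\<^esub> snd q)"

lemma hnn_orbit_closed:
  "fst q \<in> carrier F \<Longrightarrow> hnn_orbit F H \<phi> q \<in> carrier (hnn F H \<phi>)"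
proof -
  interpret G: group "hnn F H \<phi>" by (rule group_hnn)
  show "fst q \<in> carrier F \<Longrightarrow> hnn_orbit F H \<phi> q \<in> carrier (hnn F H \<phi>)"
    by (simp add: hnn_orbit_def hnn_base_closed hnn_stable_closed)
qed

text \<open>The subgroup generated by the orbits contains the base and is mapped into itself by
  conjugation with \<open>t\<close>: an orbit element over \<open>B - A\<close> moves to the next
  exponent, while one over \<open>A\<close> lands in the base. Therefore the elements of the stated
  form are closed under left multiplication by the base, by \<open>t\<close> and by its
  inverse.\<close>

lemma hnn_normal_form:
  assumes F: "group F" and B: "B \<subseteq> carrier F" "generate F B = carrier F" and A: "A \<subseteq> B"
    and H: "A \<subseteq> H" "\<phi> ` A \<subseteq> carrier F"
    and g: "g \<in> carrier (hnn F H \<phi>)"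
  shows "\<exists>m n. \<exists>v \<in> generate (hnn F H \<phi>) (hnn_orbit F H \<phi> ` orbit_index B A).
    g = inv\<^bsub>hnn F H \<phi>\<^esub> (hnn_stable F H \<phi> [^]\<^bsub>hnn F H \<phi>\<^esub> (m::nat)) \<otimes>\<^bsub>hnn F H \<phi>\<^esub> v \<otimes>\<^bsub>hnn F H \<phi>\<^esub>
          hnn_stable F H \<phi> [^]\<^bsub>hnn F H \<phi>\<^esub> (n::nat)"
proof -
  define G where "G = hnn F H \<phi>"
  define t where "t = hnn_stable F H \<phi>"
  define \<beta> where "\<beta> = hnn_base F H \<phi>"
  define S where "S = hnn_orbit F H \<phi> ` orbit_index B A"
  interpret F: group F by fact
  interpret G: group G unfolding G_def by (rule group_hnn)
  interpret \<beta>: group_hom F G \<beta>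
    unfolding \<beta>_def G_def using hnn_base_hom[OF F] group_hnn
    by (simp add: group_hom_def group_hom_axioms_def F)
  let ?V = "generate G S"
  have t: "t \<in> carrier G" by (simp add: t_def G_def hnn_stable_closed)
  have orb: "hnn_orbit F H \<phi> (b, i) = t [^]\<^bsub>G\<^esub> i \<otimes>\<^bsub>G\<^esub> \<beta> b \<otimes>\<^bsub>G\<^esub> inv\<^bsub>G\<^esub> (t [^]\<^bsub>G\<^esub> i)" for b i
    by (simp add: hnn_orbit_def G_def t_def \<beta>_def)
  have S: "S \<subseteq> carrier G"
    unfolding S_def G_def
  proof (rule image_subsetI, rule hnn_orbit_closed)
    fix q assume "q \<in> orbit_index B A"
    then show "fst q \<in> carrier F" using A B by (auto simp: orbit_index_def)
  qed
  have V: "?V \<subseteq> carrier G" using G.generate_in_carrier[OF S] by auto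
  have SV: "S \<subseteq> ?V" by (auto intro: generate.incl)
  have "\<beta> ` B \<subseteq> S"
  proof safe
    fix b assume "b \<in> B"
    then have "(b, 0) \<in> orbit_index B A" by (auto simp: orbit_index_def)
    moreover have "hnn_orbit F H \<phi> (b, 0) = \<beta> b" using \<open>b \<in> B\<close> B by (auto simp: orb)
    ultimately show "\<beta> b \<in> S" by (force simp: S_def)
  qed
  then have base: "\<beta> x \<in> ?V" if "x \<in> carrier F" for x
    using \<beta>.generate_img[OF B(1)] B(2) that G.mono_generate[of "\<beta> ` B" S] by blast
  have conj: "t \<otimes>\<^bsub>G\<^esub> v \<otimes>\<^bsub>G\<^esub> inv\<^bsub>G\<^esub> t \<in> ?V" if "v \<in> ?V" for v
  proof (rule G.conj_generate[OF t S _ that])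
    fix a assume "a \<in> S"
    then obtain b i where q: "(b, i) \<in> orbit_index B A" "a = hnn_orbit F H \<phi> (b, i)"
      by (auto simp: S_def)
    then have b: "b \<in> B" "b \<in> carrier F" using A B by (auto simp: orbit_index_def)
    show "t \<otimes>\<^bsub>G\<^esub> a \<otimes>\<^bsub>G\<^esub> inv\<^bsub>G\<^esub> t \<in> ?V"
    proof (cases "b \<in> A")
      case True
      then have "a = \<beta> b" using q b by (auto simp: orbit_index_def orb)
      moreover have "t \<otimes>\<^bsub>G\<^esub> \<beta> b \<otimes>\<^bsub>G\<^esub> inv\<^bsub>G\<^esub> t = \<beta> (\<phi> b)"
        unfolding t_def \<beta>_def G_def using True H b by (intro hnn_stable_conj) auto
      moreover have "\<beta> (\<phi> b) \<in> ?V" using True H by (intro base) auto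
      ultimately show ?thesis by simp
    next
      case False
      have "t \<otimes>\<^bsub>G\<^esub> a \<otimes>\<^bsub>G\<^esub> inv\<^bsub>G\<^esub> t = hnn_orbit F H \<phi> (b, Suc i)"
        using b t unfolding q orb by (intro G.conj_pow_Suc[symmetric]) auto
      moreover have "(b, Suc i) \<in> orbit_index B A" using False b by (simp add: orbit_index_def)
      ultimately show ?thesis using SV by (auto simp: S_def)
    qed
  qed
  have conj_pow: "t [^]\<^bsub>G\<^esub> m \<otimes>\<^bsub>G\<^esub> v \<otimes>\<^bsub>G\<^esub> inv\<^bsub>G\<^esub> (t [^]\<^bsub>G\<^esub> m) \<in> ?V" if v: "v \<in> ?V" for v and m :: nat
  proof (induction m)
    case 0
    then show ?case using v V by auto
  next
    case (Suc m)
    have "v \<in> carrier G" using v V by auto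
    then show ?case using conj[OF Suc] G.conj_pow_Suc[OF t, of v m] by metis
  qed
  have "\<exists>m n. \<exists>v \<in> ?V. g = inv\<^bsub>G\<^esub> (t [^]\<^bsub>G\<^esub> (m::nat)) \<otimes>\<^bsub>G\<^esub> v \<otimes>\<^bsub>G\<^esub> t [^]\<^bsub>G\<^esub> (n::nat)"
    using F g unfolding G_def[symmetric] t_def[symmetric] \<beta>_def[symmetric]
  proof (induction rule: hnn_induct[where F = F and H = H and \<phi> = \<phi>, folded G_def t_def \<beta>_def,
        consumes 2, case_names one base stable stable_inv])
    case one
    show ?case by (intro exI[of _ 0] bexI[of _ "\<one>\<^bsub>G\<^esub>"]) (auto intro: generate.one)
  next
    case (base x g)
    then obtain m n v where v: "v \<in> ?V"
      and g: "g = inv\<^bsub>G\<^esub> (t [^]\<^bsub>G\<^esub> (m::nat)) \<otimes>\<^bsub>G\<^esub> v \<otimes>\<^bsub>G\<^esub> t [^]\<^bsub>G\<^esub> (n::nat)" by blast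
    \<comment> \<open>Moving \<open>\<beta> x\<close> to the right of
      \<open>t\<^sup>-\<^sup>m\<close> conjugates it by \<open>t\<^sup>m\<close>.\<close>
    let ?w = "t [^]\<^bsub>G\<^esub> m \<otimes>\<^bsub>G\<^esub> \<beta> x \<otimes>\<^bsub>G\<^esub> inv\<^bsub>G\<^esub> (t [^]\<^bsub>G\<^esub> m)"
    have "?w \<in> ?V" using conj_pow \<open>\<And>x. x \<in> carrier F \<Longrightarrow> \<beta> x \<in> ?V\<close> base(1) by blast
    then have "?w \<otimes>\<^bsub>G\<^esub> v \<in> ?V" using v by (rule generate.eng)
    moreover have "\<beta> x \<otimes>\<^bsub>G\<^esub> g = inv\<^bsub>G\<^esub> (t [^]\<^bsub>G\<^esub> m) \<otimes>\<^bsub>G\<^esub> (?w \<otimes>\<^bsub>G\<^esub> v) \<otimes>\<^bsub>G\<^esub> t [^]\<^bsub>G\<^esub> n"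
      using t V v base(1) by (simp add: g subset_iff G.m_assoc[symmetric])
    ultimately show ?case by blast
  next
    case (stable g)
    then obtain m n v where v: "v \<in> ?V"
      and g: "g = inv\<^bsub>G\<^esub> (t [^]\<^bsub>G\<^esub> (m::nat)) \<otimes>\<^bsub>G\<^esub> v \<otimes>\<^bsub>G\<^esub> t [^]\<^bsub>G\<^esub> (n::nat)" by blast
    have vc: "v \<in> carrier G" using v V by auto
    show ?case
    \<comment> \<open>A positive \<open>m\<close> absorbs the factor \<open>t\<close>; for
      \<open>m = 0\<close> the factor has to pass through \<open>v\<close>, which conjugates
      \<open>v\<close>.\<close>
    proof (cases m)
      case 0
      have "t \<otimes>\<^bsub>G\<^esub> g = inv\<^bsub>G\<^esub> (t [^]\<^bsub>G\<^esub> (0::nat)) \<otimes>\<^bsub>G\<^esub> (t \<otimes>\<^bsub>G\<^esub> v \<otimes>\<^bsub>G\<^esub> inv\<^bsub>G\<^esub> t) \<otimes>\<^bsub>G\<^esub> t [^]\<^bsub>G\<^esub> Suc n"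
        using t vc by (subst G.nat_pow_Suc2) (simp_all add: g 0 G.m_assoc G.l_cancel_inv)
      then show ?thesis using conj[OF v] by blast
    next
      case (Suc k)
      have "t \<otimes>\<^bsub>G\<^esub> g = inv\<^bsub>G\<^esub> (t [^]\<^bsub>G\<^esub> k) \<otimes>\<^bsub>G\<^esub> v \<otimes>\<^bsub>G\<^esub> t [^]\<^bsub>G\<^esub> n"
        using t vc by (simp add: g Suc G.inv_mult_group G.m_assoc[symmetric])
      then show ?thesis using v by blast
    qed
  next
    case (stable_inv g)
    then obtain m n v where v: "v \<in> ?V"
      and g: "g = inv\<^bsub>G\<^esub> (t [^]\<^bsub>G\<^esub> (m::nat)) \<otimes>\<^bsub>G\<^esub> v \<otimes>\<^bsub>G\<^esub> t [^]\<^bsub>G\<^esub> (n::nat)" by blast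
    have vc: "v \<in> carrier G" using v V by auto
    have "inv\<^bsub>G\<^esub> t \<otimes>\<^bsub>G\<^esub> g = inv\<^bsub>G\<^esub> (t [^]\<^bsub>G\<^esub> Suc m) \<otimes>\<^bsub>G\<^esub> v \<otimes>\<^bsub>G\<^esub> t [^]\<^bsub>G\<^esub> n"
      using t vc by (simp add: g G.inv_mult_group G.m_assoc)
    then show ?case using v by blast
  qed
  then show ?thesis by (simp add: G_def t_def S_def)
qed

text \<open>If \<open>t\<^sup>-\<^sup>m v t\<^sup>n\<close> is in the kernel then \<open>m = n\<close> by the exponent homomorphism, so \<open>v\<close> is in the
  kernel; \<open>v\<close> is a word in the \<open>t\<^sup>i b t\<^sup>-\<^sup>i\<close>, whose images lie in the base and are free there.\<close>

lemma hnn_embedding: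
  assumes F: "group F" and B: "B \<subseteq> carrier F" "generate F B = carrier F" and A: "A \<subseteq> B"
    and H: "A \<subseteq> H" "H \<subseteq> carrier F" "\<phi> ` H \<subseteq> carrier F"
    and E: "group E" and \<Phi>: "\<Phi> \<in> mon E E" and j: "j \<in> hom F E"
    and ext: "\<And>x. x \<in> H \<Longrightarrow> \<Phi> (j x) = j (\<phi> x)"
    and free: "free_family E (\<lambda>(b, i). (\<Phi> ^^ i) (j b)) (orbit_index B A)"
  shows "\<exists>\<theta> \<in> hom (hnn F H \<phi>) (ascending_hnn E \<Phi>).
    (\<forall>x\<in>carrier F. \<theta> (hnn_base F H \<phi> x) = hnn_base E (carrier E) \<Phi> (j x)) \<and>
    \<theta> (hnn_stable F H \<phi>) = hnn_stable E (carrier E) \<Phi> \<and>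
    inj_on \<theta> (carrier (hnn F H \<phi>))"
proof -
  let ?G = "hnn F H \<phi>" and ?K = "ascending_hnn E \<Phi>"
  let ?\<beta> = "hnn_base F H \<phi>" and ?t = "hnn_stable F H \<phi>"
  let ?b = "hnn_base E (carrier E) \<Phi>" and ?s = "hnn_stable E (carrier E) \<Phi>"
  let ?\<gamma> = "hnn_orbit F H \<phi>" and ?Q = "orbit_index B A"
  interpret F: group F by fact
  interpret E: group E by fact
  interpret G: group ?G by (rule group_hnn)
  interpret K: group ?K by (rule group_hnn)
  interpret j: group_hom F E j using j by unfold_locales
  interpret \<Phi>: group_hom E E \<Phi> using \<Phi> by unfold_locales (simp add: mon_def)
  interpret b: group_hom E ?K ?b using hnn_base_hom[OF E] by unfold_locales
  have bE: "?b x \<in> carrier ?K" if "x \<in> carrier E" for x using that by (rule hnn_base_closed)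
  have s: "?s \<in> carrier ?K" and t: "?t \<in> carrier ?G" by (rule hnn_stable_closed)+
  have s_conj: "?s \<otimes>\<^bsub>?K\<^esub> ?b x \<otimes>\<^bsub>?K\<^esub> inv\<^bsub>?K\<^esub> ?s = ?b (\<Phi> x)" if "x \<in> carrier E" for x
    using that by (intro hnn_stable_conj) auto
  have bj: "?b \<circ> j \<in> hom F ?K" using Group.hom_compose[OF j b.homh] .
  have "\<exists>\<theta> \<in> hom ?G ?K. (\<forall>x\<in>carrier F. \<theta> (?\<beta> x) = (?b \<circ> j) x) \<and> \<theta> ?t = ?s"
  proof (rule hnn_universal[OF K.is_group F bj s H(2,3)])
    fix x assume "x \<in> H"
    then show "?s \<otimes>\<^bsub>?K\<^esub> (?b \<circ> j) x \<otimes>\<^bsub>?K\<^esub> inv\<^bsub>?K\<^esub> ?s = (?b \<circ> j) (\<phi> x)"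
      using s_conj[of "j x"] ext[of x] H(2) by auto
  qed
  then obtain \<theta> where \<theta>: "\<theta> \<in> hom ?G ?K" and \<theta>_base: "\<And>x. x \<in> carrier F \<Longrightarrow> \<theta> (?\<beta> x) = ?b (j x)"
    and \<theta>_t: "\<theta> ?t = ?s" by auto
  interpret \<theta>: group_hom ?G ?K \<theta> using \<theta> by unfold_locales
  obtain e where e: "e \<in> hom ?K integer_group" and e_base: "\<And>x. x \<in> carrier E \<Longrightarrow> e (?b x) = 0"
    and e_s: "e ?s = 1"
    using hnn_exponent_hom[OF E subset_refl] \<Phi>.hom_closed by (metis image_subset_iff)
  interpret e: group_hom ?K integer_group e
    by (intro group_hom.intro group_hom_axioms.intro group_hnn group_integer_group e)
  let ?g = "\<lambda>(b, i). (\<Phi> ^^ i) (j b)"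
  have Q: "fst q \<in> carrier F" if "q \<in> ?Q" for q
    using that A B by (auto simp: orbit_index_def)
  have \<gamma>: "?\<gamma> ` ?Q \<subseteq> carrier ?G" using Q hnn_orbit_closed by blast
  have g: "?g ` ?Q \<subseteq> carrier E" using free by (simp add: free_family_def)
  have \<Phi>_pow: "(\<Phi> ^^ i) x \<in> carrier E" if "x \<in> carrier E" for x i
    using that by (induction i) auto
  have conj_pow: "?s [^]\<^bsub>?K\<^esub> i \<otimes>\<^bsub>?K\<^esub> ?b x \<otimes>\<^bsub>?K\<^esub> inv\<^bsub>?K\<^esub> (?s [^]\<^bsub>?K\<^esub> i) = ?b ((\<Phi> ^^ i) x)"
    if x: "x \<in> carrier E" for x and i :: nat
  proof (induction i)
    case 0
    then show ?case using bE[OF x] by simp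
  next
    case (Suc i)
    then show ?case
      using s_conj[OF \<Phi>_pow[OF x, of i]] K.conj_pow_Suc[OF s bE[OF x], of i] by simp
  qed
  have \<theta>_\<gamma>: "\<theta> (?\<gamma> q) = (?b \<circ> ?g) q" if "q \<in> ?Q" for q
  proof -
    have x: "fst q \<in> carrier F" using that by (rule Q)
    then have "\<theta> (?\<gamma> q) =
        ?s [^]\<^bsub>?K\<^esub> snd q \<otimes>\<^bsub>?K\<^esub> ?b (j (fst q)) \<otimes>\<^bsub>?K\<^esub> inv\<^bsub>?K\<^esub> (?s [^]\<^bsub>?K\<^esub> snd q)"
      using t by (simp add: hnn_orbit_def hnn_base_closed \<theta>_base \<theta>_t \<theta>.hom_nat_pow)
    then show ?thesis using conj_pow[of "j (fst q)" "snd q"] x by (simp add: case_prod_beta)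
  qed
  have inj: "g' = \<one>\<^bsub>?G\<^esub>" if g': "g' \<in> carrier ?G" "\<theta> g' = \<one>\<^bsub>?K\<^esub>" for g'
  proof -
    obtain m n :: nat and v where v: "v \<in> generate ?G (?\<gamma> ` ?Q)"
      and g'_eq: "g' = inv\<^bsub>?G\<^esub> (?t [^]\<^bsub>?G\<^esub> m) \<otimes>\<^bsub>?G\<^esub> v \<otimes>\<^bsub>?G\<^esub> ?t [^]\<^bsub>?G\<^esub> n"
      using hnn_normal_form[OF F B A H(1) _ g'(1)] A H by blast
    obtain w where w: "w \<in> gwords ?Q" "v = gword_val ?G ?\<gamma> w"
      using v unfolding G.generate_eq_gword_val[OF \<gamma>] by auto
    have vc: "v \<in> carrier ?G" using G.gword_val_closed[OF \<gamma> w(1)] w(2) by simp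
    have gc: "gword_val E ?g w \<in> carrier E" by (rule E.gword_val_closed[OF g w(1)])
    have "\<theta> v = gword_val ?K (\<theta> \<circ> ?\<gamma>) w" using \<theta>.hom_gword_val[OF \<gamma> w(1)] w(2) by simp
    also have "\<dots> = gword_val ?K (?b \<circ> ?g) w"
      using \<theta>_\<gamma> by (intro gword_val_cong[OF w(1)]) simp
    also have "\<dots> = ?b (gword_val E ?g w)" by (rule b.hom_gword_val[OF g w(1), symmetric])
    finally have \<theta>v: "\<theta> v = ?b (gword_val E ?g w)" .
    have \<theta>g': "\<theta> g' = inv\<^bsub>?K\<^esub> (?s [^]\<^bsub>?K\<^esub> m) \<otimes>\<^bsub>?K\<^esub> \<theta> v \<otimes>\<^bsub>?K\<^esub> ?s [^]\<^bsub>?K\<^esub> n"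
      using t vc by (simp add: g'_eq \<theta>_t \<theta>.hom_nat_pow)
    then have "e (\<theta> g') = - int m + int n"
      using s vc e_base[OF gc] by (simp add: \<theta>v e_s e.hom_nat_pow bE[OF gc])
    then have "m = n" using g'(2) by simp
    have "\<theta> v = \<one>\<^bsub>?K\<^esub>"
    proof -
      let ?p = "?s [^]\<^bsub>?K\<^esub> m"
      have "\<theta> v = ?p \<otimes>\<^bsub>?K\<^esub> (inv\<^bsub>?K\<^esub> ?p \<otimes>\<^bsub>?K\<^esub> \<theta> v \<otimes>\<^bsub>?K\<^esub> ?p) \<otimes>\<^bsub>?K\<^esub> inv\<^bsub>?K\<^esub> ?p"
        using K.l_cancel_inv[of "inv\<^bsub>?K\<^esub> ?p"] s vc by (simp add: K.m_assoc)
      also have "inv\<^bsub>?K\<^esub> ?p \<otimes>\<^bsub>?K\<^esub> \<theta> v \<otimes>\<^bsub>?K\<^esub> ?p = \<one>\<^bsub>?K\<^esub>"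
        using HOL.trans[OF \<theta>g'[symmetric] g'(2)] \<open>m = n\<close> by simp
      also have "?p \<otimes>\<^bsub>?K\<^esub> \<one>\<^bsub>?K\<^esub> \<otimes>\<^bsub>?K\<^esub> inv\<^bsub>?K\<^esub> ?p = \<one>\<^bsub>?K\<^esub>" using s by simp
      finally show ?thesis .
    qed
    then have "?b (gword_val E ?g w) = ?b \<one>\<^bsub>E\<^esub>" using \<theta>v by simp
    \<comment> \<open>The base embeds into the ascending extension, so the relation already holds in
      \<open>E\<close>.\<close>
    then have "gword_val E ?g w = \<one>\<^bsub>E\<^esub>"
      using inj_onD[OF inj_on_ascending_hnn_base[OF E \<Phi>]] gc by blast
    then have "free_reduce w = []" by (rule E.free_family_eq_one[OF free w(1)])
    then have "v = \<one>\<^bsub>?G\<^esub>" using G.gword_val_free_reduce[OF \<gamma> w(1)] w(2) by simp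
    then show ?thesis using t by (simp add: g'_eq \<open>m = n\<close>)
  qed
  have "inj_on \<theta> (carrier ?G)" unfolding \<theta>.inj_on_one_iff using inj by auto
  then show ?thesis using \<theta> \<theta>_base \<theta>_t by blast
qed

section \<open>The extended endomorphism\<close>

text \<open>Basis elements are replaced by numbers: \<open>B\<close> stands for the basis of
  \<open>F\<close>, \<open>A\<close> for the part generating \<open>F'\<close>, \<open>f\<close> for
  the images under \<phi> as words over \<open>B\<close>, and \<open>x\<close>, \<open>y\<close> are
  the two new letters. Freeness of \<open>f\<close> on \<open>A\<close> expresses injectivity of
  \<phi>.\<close>

locale extended_endo =
  fixes A B :: "nat set" and x y :: nat and f :: "nat \<Rightarrow> nat gword"
  assumes AB: "A \<subseteq> B" and xy: "x \<noteq> y" "x \<notin> B" "y \<notin> B"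
    and f: "free_family (word_group B) f A"
begin

definition "X = B \<union> {x, y}"
definition "E = word_group X"
text \<open>The letters are numbers, so a letter can serve as its own exponent, and distinct letters
  outside \<open>A\<close> receive distinct conjugates.\<close>

definition "f_ext i = (if i \<in> A then f i else conj_word x y i)"
definition "\<Phi> = gword_val E f_ext"
definition "letter_orbit = (\<lambda>(b, i). (\<Phi> ^^ i) [(b, True)])"

lemma group_E: "group E"
  by (simp add: E_def group_word_group)

lemma f_ext_closed:
  "i \<in> A \<Longrightarrow> f_ext i \<in> carrier (word_group B)"
  "i \<notin> A \<Longrightarrow> f_ext i \<in> carrier (word_group {x, y})"
  using f conj_word_closed[OF xy(1)] by (auto simp: f_ext_def free_family_def)

text \<open>Letters in \<open>A\<close> go to words over \<open>B\<close>, the others to words over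
  \<open>{x, y}\<close>. As these alphabets are disjoint, freeness on each part suffices.\<close>

lemma free_family_f_ext: "free_family E f_ext X"
  unfolding E_def
proof (rule free_family_coloured[where c = "\<lambda>i. i \<in> A" and d = "\<lambda>z. z \<in> B"])
  have B: "{z \<in> X. z \<in> B} = B" and D: "{z \<in> X. z \<notin> B} = {x, y}"
    using xy by (auto simp: X_def)
  show "f_ext i \<in> carrier (word_group {z \<in> X. (z \<in> B) = (i \<in> A)})" for i
    using f_ext_closed[of i] by (cases "i \<in> A") (simp_all add: B D)
  show "free_family (word_group X) f_ext {i \<in> X. (i \<in> A) = k}" for k
  proof (cases k)
    case True
    have "free_family (word_group X) f A"
      by (rule free_family_word_group_mono[OF _ f]) (auto simp: X_def)
    then have "free_family (word_group X) f_ext A"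
      by (rule free_family_cong) (simp add: f_ext_def)
    then show ?thesis by (rule free_family_mono) (use True AB in \<open>auto simp: X_def\<close>)
  next
    case False
    have "free_family (word_group X) (conj_word x y) UNIV"
      by (rule free_family_word_group_mono[OF _ free_family_conj_word[OF xy(1)]]) (simp add: X_def)
    then have "free_family (word_group X) (conj_word x y) {i \<in> X. i \<notin> A}"
      by (rule free_family_mono) simp
    then have "free_family (word_group X) f_ext {i \<in> X. i \<notin> A}"
      by (rule free_family_cong) (simp add: f_ext_def)
    then show ?thesis using False by simp
  qed
qed

lemma \<Phi>_mon: "\<Phi> \<in> mon E E"
  using group.free_family_mon[OF group_E free_family_f_ext] by (simp add: \<Phi>_def E_def)

lemma \<Phi>_letter: "a \<in> A \<Longrightarrow> \<Phi> [(a, True)] = f a"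
proof -
  assume a: "a \<in> A"
  have "f_ext a \<in> carrier E"
    using free_family_f_ext a AB by (auto simp: free_family_def X_def)
  then show "\<Phi> [(a, True)] = f a"
    using a group.is_monoid[OF group_E] by (simp add: \<Phi>_def f_ext_def monoid.r_one)
qed

text \<open>Without letters from \<open>A\<close>, only conjugates and their inverses are
  multiplied. So one application of \<open>\<Phi>\<close> leads into the words over
  \<open>{x, y}\<close>, where further applications stay.\<close>

lemma \<Phi>_closed:
  assumes "w \<in> carrier (word_group (X - A))"
  shows "\<Phi> w \<in> carrier (word_group {x, y})"
  unfolding \<Phi>_def E_def
  by (rule gword_val_word_group_closed[where X = "X - A"])
     (use assms f_ext_closed in \<open>auto simp: X_def\<close>)

lemma letter_orbit_closed:
  assumes "b \<in> B - A"
  shows "letter_orbit (b, i) \<in> carrier (word_group (X - A))"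
proof (induction i)
  case 0
  then show ?case using assms by (simp add: letter_orbit_def X_def gword_reduced_Cons)
next
  case (Suc i)
  have "{x, y} \<subseteq> X - A" using xy AB by (auto simp: X_def)
  then show ?case
    using \<Phi>_closed[OF Suc] gwords_mono[of "{x, y}" "X - A"] by (auto simp: letter_orbit_def)
qed

lemma letter_orbit_Suc_closed:
  "b \<in> B - A \<Longrightarrow> letter_orbit (b, Suc i) \<in> carrier (word_group {x, y})"
  using \<Phi>_closed[OF letter_orbit_closed] by (simp add: letter_orbit_def)

text \<open>The free family \<open>{\<Phi>\<^sup>i c | i \<le> n}\<close> is the union of the letters \<open>c\<close>, which avoid
  \<open>x\<close> and \<open>y\<close>, and of the image under \<open>\<Phi>\<close> of the family for \<open>n - 1\<close>, whose members are words
  in \<open>x\<close> and \<open>y\<close>.\<close>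

lemma free_family_letter_orbit_bounded: "free_family E letter_orbit ((B - A) \<times> {..<n})"
proof (induction n)
  case 0
  then show ?case by (auto simp: free_family_def gwords_def)
next
  case (Suc n)
  let ?Q = "(B - A) \<times> {..<Suc n}"
  have D: "{z \<in> X. z \<notin> B} = {x, y}" using xy by (auto simp: X_def)
  have BA: "B - A \<subseteq> {z \<in> X. z \<in> B}" by (auto simp: X_def)
  show ?case
    unfolding E_def
  proof (rule free_family_coloured[where c = "\<lambda>q. snd q = 0" and d = "\<lambda>z. z \<in> B"])
    fix q assume "q \<in> ?Q"
    then obtain b i where q: "q = (b, i)" "b \<in> B - A" by auto
    show "letter_orbit q \<in> carrier (word_group {z \<in> X. (z \<in> B) = (snd q = 0)})"
    proof (cases i)
      case 0
      then show ?thesis using q BA by (auto simp: letter_orbit_def gword_reduced_Cons)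
    next
      case (Suc k)
      then show ?thesis using q letter_orbit_Suc_closed[of b k] by (simp add: D)
    qed
  next
    fix k
    show "free_family (word_group X) letter_orbit {q \<in> ?Q. (snd q = 0) = k}"
    proof (cases k)
      case True
      have "free_family (word_group X) ((\<lambda>x. [(x, True)]) \<circ> fst) {q \<in> ?Q. snd q = 0}"
        by (rule free_family_reindex[OF free_family_letters[of X X]])
           (auto simp: inj_on_def X_def)
      then have "free_family (word_group X) letter_orbit {q \<in> ?Q. snd q = 0}"
        by (rule free_family_cong) (auto simp: letter_orbit_def)
      then show ?thesis using True by simp
    next
      case False
      have "free_family (word_group X) (\<Phi> \<circ> letter_orbit) ((B - A) \<times> {..<n})"
        using free_family_comp_mon[OF group_E group_E \<Phi>_mon Suc] by (simp add: E_def)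
      \<comment> \<open>The induction hypothesis is moved up by one exponent; the truncated
        subtraction is injective here because \<open>snd q \<noteq> 0\<close>.\<close>
      then have "free_family (word_group X) (\<Phi> \<circ> letter_orbit \<circ> (\<lambda>(b, i). (b, i - 1)))
          {q \<in> ?Q. snd q \<noteq> 0}"
        by (rule free_family_reindex) (auto simp: inj_on_def)
      then have "free_family (word_group X) letter_orbit {q \<in> ?Q. snd q \<noteq> 0}"
      proof (rule free_family_cong)
        fix q assume "q \<in> {q \<in> ?Q. snd q \<noteq> 0}"
        then obtain b i where "q = (b, Suc i)" by (cases q; cases "snd q") auto
        then show "(\<Phi> \<circ> letter_orbit \<circ> (\<lambda>(b, i). (b, i - 1))) q = letter_orbit q"
          by (simp add: letter_orbit_def)
      qed
      then show ?thesis using False by simp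
    qed
  qed
qed

text \<open>The letters of \<open>A\<close> are separated from the remaining orbits, which are words
  over \<open>X - A\<close>. A finite set of indices has bounded exponents, so the bounded case
  applies to the latter.\<close>

lemma free_family_letter_orbit: "free_family E letter_orbit (orbit_index B A)"
  unfolding E_def
proof (rule free_family_coloured[where c = "\<lambda>q. fst q \<in> A" and d = "\<lambda>z. z \<in> A"])
  have X: "{z \<in> X. z \<in> A} = A" "{z \<in> X. z \<notin> A} = X - A" using AB by (auto simp: X_def)
  show "letter_orbit q \<in> carrier (word_group {z \<in> X. (z \<in> A) = (fst q \<in> A)})"
    if "q \<in> orbit_index B A" for q
  proof (cases "fst q \<in> A")
    case True
    then show ?thesis
      using that by (auto simp: orbit_index_def X letter_orbit_def gword_reduced_Cons)
  next
    case False
    then have "q = (fst q, snd q)" "fst q \<in> B - A" using that by (auto simp: orbit_index_def)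
    then show ?thesis using False letter_orbit_closed[of "fst q" "snd q"] by (simp add: X)
  qed
  show "free_family (word_group X) letter_orbit {q \<in> orbit_index B A. (fst q \<in> A) = k}" for k
  proof (cases k)
    case True
    have "free_family (word_group X) ((\<lambda>x. [(x, True)]) \<circ> fst) (A \<times> {0})"
      by (rule free_family_reindex[OF free_family_letters[of X X]])
         (use AB in \<open>auto simp: inj_on_def X_def\<close>)
    then have "free_family (word_group X) letter_orbit (A \<times> {0})"
      by (rule free_family_cong) (auto simp: letter_orbit_def)
    then show ?thesis
      by (rule free_family_mono) (use True in \<open>auto simp: orbit_index_def\<close>)
  next
    case False
    show ?thesis
    proof (rule free_family_finite_subsets)
      fix Y assume Y: "finite Y" "Y \<subseteq> {q \<in> orbit_index B A. (fst q \<in> A) = k}"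
      obtain n where "snd ` Y \<subseteq> {..<n}"
        using Y(1) finite_nat_iff_bounded[of "snd ` Y"] by auto
      then have "Y \<subseteq> (B - A) \<times> {..<n}"
        using Y(2) False by (force simp: orbit_index_def)
      then show "free_family (word_group X) letter_orbit Y"
        using free_family_mono[OF free_family_letter_orbit_bounded] by (simp add: E_def)
    qed
  qed
qed

end

section \<open>Embedding partial ascending HNN extensions\<close>

theorem theorem1p1:
  fixes F :: "('a, 'm) monoid_scheme" and F' :: "'a set" and \<phi> :: "'a \<Rightarrow> 'a"
  assumes "is_free_group F"
    and "finitely_generated_group F"
    and "free_factor F F'"
    and "\<phi> \<in> mon (F\<lparr>carrier := F'\<rparr>) F"
  shows
    "(\<exists>(E :: nat gword monoid) \<Psi> \<theta>.
        is_free_group E \<and> finitely_generated_group E \<and> \<Psi> \<in> mon E E \<and>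
        \<theta> \<in> mon (hnn F F' \<phi>) (ascending_hnn E \<Psi>)) \<and>
     (\<exists>(F'' :: nat gword monoid) j \<Phi>.
        is_free_group F'' \<and> finitely_generated_group F'' \<and>
        j \<in> mon F F'' \<and> \<Phi> \<in> mon F'' F'' \<and>
        (\<forall>x\<in>F'. \<Phi> (j x) = j (\<phi> x)) \<and>
        (\<exists>\<theta> \<in> hom (hnn F F' \<phi>) (ascending_hnn F'' \<Phi>).
           (\<forall>x\<in>carrier F. \<theta> (hnn_base F F' \<phi> x) = hnn_base F'' (carrier F'') \<Phi> (j x)) \<and>
           \<theta> (hnn_stable F F' \<phi>) = hnn_stable F'' (carrier F'') \<Phi> \<and>
           inj_on \<theta> (carrier (hnn F F' \<phi>))))"
proof -
  have F: "group F" using assms(1) by (simp add: is_free_group_def)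
  interpret F: group F by fact
  obtain B A where basis: "free_basis F B" and A: "A \<subseteq> B" and F': "F' = generate F A"
    using assms(3) by (auto simp: free_factor_def)
  have B: "B \<subseteq> carrier F" using basis by (simp add: free_basis_def)
  have A_id: "id ` A \<subseteq> carrier F" "id ` A \<subseteq> F'" using A B by (auto simp: F' intro: generate.incl)
  have F'_sub: "subgroup F' F" using F.generate_is_subgroup A_id(1) by (simp add: F')
  have F'_words: "F' = gword_val F id ` gwords A"
    using F.generate_eq_gword_val[OF A_id(1)] by (simp add: F')
  have iso: "gword_val F id \<in> iso (word_group B) F" by (rule free_basis_iso[OF F basis])
  have "carrier F = gword_val F id ` carrier (word_group B)"
    using iso by (simp add: iso_def bij_betw_def)
  also have "\<dots> \<subseteq> gword_val F id ` gwords B" by auto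
  also have "\<dots> = generate F B" using F.generate_eq_gword_val[of id B] B by simp
  finally have gen_B: "generate F B = carrier F" using F.generate_incl[OF B] by auto
  interpret F': group "F\<lparr>carrier := F'\<rparr>" by (rule F.subgroup_imp_group[OF F'_sub])
  interpret \<phi>: group_hom "F\<lparr>carrier := F'\<rparr>" F \<phi>
    using assms(4)
    by (intro group_hom.intro group_hom_axioms.intro F F'.is_group) (simp add: mon_def)
  have \<phi>_closed: "\<phi> x \<in> carrier F" if "x \<in> F'" for x using \<phi>.hom_closed[of x] that by simp

  \<comment> \<open>Numbering the basis\<close>
  have "finite B" by (rule free_basis_finite[OF F basis assms(2)])
  then obtain \<iota> :: "'a \<Rightarrow> nat" where \<iota>: "bij_betw \<iota> B {0..<card B}"
    using ex_bij_betw_finite_nat by blast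
  define N where "N = card B"
  have \<iota>_inj: "inj_on \<iota> B" and \<iota>_img: "\<iota> ` B = {0..<N}" using \<iota> by (auto simp: bij_betw_def N_def)
  \<comment> \<open>The map \<open>j0\<close> renames letters. Composed with the inverse of word
    evaluation it gives \<open>j\<close>, which writes an element of \<open>F\<close> as its reduced
    word in numbered letters.\<close>
  define j0 where "j0 = gword_val (word_group {0..<N}) (\<lambda>b. [(\<iota> b, True)])"
  define j where "j = j0 \<circ> inv_into (carrier (word_group B)) (gword_val F id)"
  have "free_family (word_group {0..<N}) ((\<lambda>x. [(x, True)]) \<circ> \<iota>) B"
    by (rule free_family_reindex[OF free_family_letters[OF subset_refl] \<iota>_inj]) (simp add: \<iota>_img)
  then have j0: "j0 \<in> mon (word_group B) (word_group {0..<N})"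
    using group.free_family_mon[OF group_word_group] by (simp add: j0_def comp_def)
  have inv_iso: "inv_into (carrier (word_group B)) (gword_val F id) \<in> iso F (word_group B)"
    by (rule group.iso_set_sym[OF group_word_group iso])
  have j_mon: "j \<in> mon F (word_group {0..<N})"
    unfolding mon_def j_def
  proof (intro CollectI conjI)
    show "j0 \<circ> inv_into (carrier (word_group B)) (gword_val F id) \<in> hom F (word_group {0..<N})"
      by (rule Group.hom_compose) (use j0 inv_iso in \<open>auto simp: mon_def iso_def\<close>)
    show "inj_on (j0 \<circ> inv_into (carrier (word_group B)) (gword_val F id)) (carrier F)"
      using j0 inv_iso by (intro comp_inj_on) (simp_all add: mon_def iso_def bij_betw_def)
  qed
  have j_letter: "j b = [(\<iota> b, True)]" if "b \<in> B" for b
  proof -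
    have "[(b, True)] \<in> carrier (word_group B)" using that by (simp add: gword_reduced_Cons)
    moreover have "gword_val F id [(b, True)] = b" using that B by auto
    ultimately have "inv_into (carrier (word_group B)) (gword_val F id) b = [(b, True)]"
      using iso inv_into_f_f[of "gword_val F id" "carrier (word_group B)" "[(b, True)]"]
      by (simp add: iso_def bij_betw_def)
    then show ?thesis
      using that \<iota>_img by (auto simp: j_def j0_def)
  qed
  interpret j: group_hom F "word_group {0..<N}" j
    using j_mon by (simp add: group_hom_def group_hom_axioms_def F group_word_group mon_def)

  \<comment> \<open>Extending the monomorphism\<close>
  define \<kappa> where "\<kappa> = inv_into B \<iota>"
  have \<kappa>: "\<kappa> (\<iota> b) = b" if "b \<in> B" for b using that \<iota>_inj by (simp add: \<kappa>_def)
  have \<iota>_mem: "\<iota> b \<in> \<iota> ` A \<longleftrightarrow> b \<in> A" if "b \<in> B" for b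
    by (rule inj_on_image_mem_iff[OF \<iota>_inj that A])
  have "free_family (F\<lparr>carrier := F'\<rparr>) id A"
    using free_family_mono[OF free_basis_free_family[OF F basis] A] A_id(2)
      gword_val_restrict_carrier[OF F F'_sub A_id(2)]
    by (simp add: free_family_def)
  \<comment> \<open>Both \<phi> and \<open>j\<close> are injective, so they preserve the freeness of
    \<open>A\<close> in \<open>F'\<close>.\<close>
  then have "free_family (word_group {0..<N}) (j \<circ> (\<phi> \<circ> id)) A"
    by (intro free_family_comp_mon[OF F group_word_group j_mon]
        free_family_comp_mon[OF F'.is_group F assms(4)])
  then have "free_family (word_group {0..<N}) (j \<circ> (\<phi> \<circ> id) \<circ> \<kappa>) (\<iota> ` A)"
  proof (rule free_family_reindex)
    show "inj_on \<kappa> (\<iota> ` A)" unfolding \<kappa>_def using A by (intro inj_on_inv_into) auto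
    show "\<kappa> ` \<iota> ` A \<subseteq> A" using \<kappa> A by (auto simp: subset_iff)
  qed
  \<comment> \<open>The old letters are the numbers below \<open>N\<close>, so \<open>N\<close> and
    \<open>Suc N\<close> serve as the new ones.\<close>
  then interpret X: extended_endo "\<iota> ` A" "{0..<N}" N "Suc N" "\<lambda>i. j (\<phi> (\<kappa> i))"
    using A \<iota>_img by unfold_locales (auto simp: comp_def)
  interpret E: group X.E by (rule X.group_E)
  interpret \<Phi>: group_hom X.E X.E X.\<Phi> using X.\<Phi>_mon by unfold_locales (simp add: mon_def)
  have incl: "id \<in> mon (word_group {0..<N}) X.E"
    unfolding X.E_def by (rule mon_word_group_inclusion) (auto simp: X.X_def)
  have j_hom: "j \<in> hom F X.E"
    using Group.hom_compose[of j F "word_group {0..<N}" id X.E] j_mon incl by (simp add: mon_def)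
  have jE: "j \<in> mon F X.E" using j_hom j_mon by (simp add: mon_def)
  interpret jE: group_hom F X.E j using j_hom by unfold_locales
  have ext_letter: "X.\<Phi> (j a) = j (\<phi> a)" if "a \<in> A" for a
  proof -
    have "a \<in> B" using that A by auto
    then show ?thesis using X.\<Phi>_letter[of "\<iota> a"] that by (simp add: j_letter \<kappa>)
  qed
  \<comment> \<open>Both sides are homomorphic in \<open>x\<close>, and \<open>F'\<close> consists
    of values of words over \<open>A\<close>, so agreement on \<open>A\<close> suffices.\<close>
  have ext: "X.\<Phi> (j x) = j (\<phi> x)" if "x \<in> F'" for x
  proof -
    obtain w where w: "w \<in> gwords A" "x = gword_val F id w" using \<open>x \<in> F'\<close> F'_words by auto
    have jA: "(j \<circ> id) ` A \<subseteq> carrier X.E" using A_id(1) by auto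
    have \<phi>A: "(\<phi> \<circ> id) ` A \<subseteq> carrier F" using A_id(2) \<phi>_closed by auto
    have "X.\<Phi> (j x) = gword_val X.E (X.\<Phi> \<circ> (j \<circ> id)) w"
      unfolding w(2) jE.hom_gword_val[OF A_id(1) w(1)] by (rule \<Phi>.hom_gword_val[OF jA w(1)])
    also have "\<dots> = gword_val X.E (j \<circ> (\<phi> \<circ> id)) w"
      by (rule gword_val_cong[OF w(1)]) (simp add: ext_letter)
    also have "\<dots> = j (gword_val F (\<phi> \<circ> id) w)" by (rule jE.hom_gword_val[OF \<phi>A w(1), symmetric])
    also have "gword_val F (\<phi> \<circ> id) w = \<phi> (gword_val (F\<lparr>carrier := F'\<rparr>) id w)"
      by (rule \<phi>.hom_gword_val[symmetric, OF _ w(1)]) (use A_id(2) in simp)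
    also have "\<dots> = \<phi> x"
      using gword_val_restrict_carrier[OF F F'_sub A_id(2) w(1)] w(2) by simp
    finally show ?thesis .
  qed

  \<comment> \<open>Freeness of the orbits and the embedding\<close>
  have "free_family X.E (X.letter_orbit \<circ> map_prod \<iota> id) (orbit_index B A)"
  proof (rule free_family_reindex[OF X.free_family_letter_orbit])
    have "orbit_index B A \<subseteq> B \<times> UNIV" using A by (auto simp: orbit_index_def)
    then show "inj_on (map_prod \<iota> id) (orbit_index B A)"
      using map_prod_inj_on[OF \<iota>_inj inj_on_id[of UNIV]] by (rule inj_on_subset[rotated])
    show "map_prod \<iota> id ` orbit_index B A \<subseteq> orbit_index {0..<N} (\<iota> ` A)"
      unfolding \<iota>_img[symmetric] orbit_index_def using \<iota>_mem A by fastforce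
  qed
  then have orbit: "free_family X.E (\<lambda>(b, i). (X.\<Phi> ^^ i) (j b)) (orbit_index B A)"
    by (rule free_family_cong)
      (use A in \<open>auto simp: orbit_index_def X.letter_orbit_def j_letter subset_iff\<close>)
  have emb: "\<exists>\<theta> \<in> hom (hnn F F' \<phi>) (ascending_hnn X.E X.\<Phi>).
      (\<forall>x\<in>carrier F. \<theta> (hnn_base F F' \<phi> x) = hnn_base X.E (carrier X.E) X.\<Phi> (j x)) \<and>
      \<theta> (hnn_stable F F' \<phi>) = hnn_stable X.E (carrier X.E) X.\<Phi> \<and>
      inj_on \<theta> (carrier (hnn F F' \<phi>))"
  proof (rule hnn_embedding[OF F B gen_B A _ _ _ X.group_E X.\<Phi>_mon j_hom ext orbit])
    show "A \<subseteq> F'" "F' \<subseteq> carrier F" "\<phi> ` F' \<subseteq> carrier F"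
      using A_id(2) subgroup.subset[OF F'_sub] \<phi>_closed by auto
  qed
  then obtain \<theta> where "\<theta> \<in> mon (hnn F F' \<phi>) (ascending_hnn X.E X.\<Phi>)"
    by (auto simp: mon_def)
  moreover have "is_free_group X.E" "finitely_generated_group X.E"
    unfolding X.E_def
    by (simp_all add: is_free_group_word_group finitely_generated_word_group X.X_def)
  \<comment> \<open>The same ascending extension witnesses both conjuncts; the first only forgets
    how the embedding arises.\<close>
  ultimately show ?thesis
    using jE X.\<Phi>_mon ext emb
    by (intro conjI exI[of _ X.E] exI[of _ X.\<Phi>] exI[of _ \<theta>] exI[of _ j] ballI)
qed

end
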